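(* Let $s\in(0,1)$, $p\ge\frac{2}{2-s}$, let $\Omega\subsetneq\mathbb R^n$ be a smooth domain and assume without loss of generality that $0\in\Omega$. Let $B_R(0)\subset\Omega$ and let $u$ be a smooth function on $\mathbb R^n$ that is positive, radially symmetric and strictly decreasing along the radius in $B_R(0)$, and $0$ outside $B_R(0)$. Then $$(-\Delta)_p^su(0)-(-\Delta_\Omega)_p^su(0)=C_2\int_0^\infty\!\int_\Omega\big(K_{\mathbb R^n}(t,0,y)-K_\Omega(t,0,y)\big)\Phi_p(u(0)-u(y))\,dy\,\frac{dt}{t^{1+\frac{sp}{2}}}+C_2\int_0^\infty\!\int_{\mathbb R^n\setminus\Omega}K_{\mathbb R^n}(t,0,y)\,\Phi_p(u(0)-u(y))\,dy\,\frac{dt}{t^{1+\frac{sp}{2}}}>0 .$$ Consequently, the operator $(-\Delta_\Omega)_p^s$ is different from the usual operator on domains, which uses the formula of $(-\Delta)_p^s$ restricted to functions $u$ defined in $\mathbb R^n$ such that $u=0$ outside $\Omega$.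
   Context: $\Phi_p(t)=|t|^{p-2}t$ (with $\Phi_p(0)=0$). The fractional $p$-Laplacian is $$(-\Delta)_p^s u(x)=C_1\,\mathrm{P.V.}\int_{\mathbb R^n}\frac{\Phi_p(u(x)-u(y))}{|x-y|^{n+sp}}\,dy,\qquad \mathrm{P.V.}\int_{\mathbb R^n}=\lim_{\varepsilon\to0^+}\int_{|x-y|>\varepsilon},$$ with a fixed constant $C_1=C_1(n,s,p)>0$, and the spectral-type operator on $\Omega$ is $$(-\Delta_\Omega)_p^su(x)=C_2\int_0^{+\infty}e^{t\Delta_\Omega}\big[\Phi_p(u(x)-u(\cdot))\big](x)\,\frac{dt}{t^{1+\frac{sp}{2}}},\qquad C_2=\frac{\pi^{\frac n2}C_1}{2^{sp}\Gamma\left(\frac{n+sp}{2}\right)} .$$ Here $e^{t\Delta_\Omega}$ is the heat semigroup in $\Omega$ with homogeneous Dirichlet boundary conditions, $e^{t\Delta_\Omega}[f](x)=\int_\Omega K_\Omega(t,x,y)f(y)\,dy$ with $K_\Omega$ the Dirichlet heat kernel of $\Omega$; it acts on $y\mapsto\Phi_p(u(x)-u(y))$, $y\in\Omega$. $K_{\mathbb R^n}(t,x,y)=(4\pi t)^{-n/2}e^{-|x-y|^2/(4t)}$ is the heat kernel of $\mathbb R^n$.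
   Formalization: At p = 2/(2-s) both operators may be +∞ at 0 (when u has nonzero Hessian there), so the difference is undefined; there the identity is stated when the operators are finite, and otherwise as the limit of the differences of the integrals truncated to |y|>ε. *)

theory Defs
  imports "HOL-Analysis.Analysis"
begin

section \<open>Smooth functions and smooth domains\<close>

text \<open>\<open>Ck_on k f S\<close> is meant for open sets \<open>S\<close>.\<close>

fun Ck_on :: "nat \<Rightarrow> ('a::euclidean_space \<Rightarrow> real) \<Rightarrow> 'a set \<Rightarrow> bool" where
  "Ck_on 0 f S \<longleftrightarrow> continuous_on S f"
| "Ck_on (Suc k) f S \<longleftrightarrow>
     (\<forall>x\<in>S. f differentiable (at x)) \<and>
     (\<forall>i\<in>Basis. Ck_on k (\<lambda>x. frechet_derivative f (at x) i) S)"

definition smooth_fun_on :: "('a::euclidean_space \<Rightarrow> real) \<Rightarrow> 'a set \<Rightarrow> bool" where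
  "smooth_fun_on f S \<longleftrightarrow> (\<forall>k. Ck_on k f S)"

definition laplacian :: "('a::euclidean_space \<Rightarrow> real) \<Rightarrow> 'a \<Rightarrow> real" where
  "laplacian f x =
     (\<Sum>i\<in>Basis. frechet_derivative (\<lambda>z. frechet_derivative f (at z) i) (at x) i)"

text \<open>The boundary is locally the regular zero set of a smooth function, with the domain on
  exactly one side of it.\<close>

definition smooth_domain :: "'a::euclidean_space set \<Rightarrow> bool" where
  "smooth_domain \<Omega> \<longleftrightarrow>
     open \<Omega> \<and> connected \<Omega> \<and> \<Omega> \<noteq> {} \<and>
     (\<forall>z\<in>frontier \<Omega>. \<exists>U \<rho>. open U \<and> z \<in> U \<and> smooth_fun_on \<rho> U \<and>
        (\<forall>x\<in>U. frechet_derivative \<rho> (at x) \<noteq> (\<lambda>h. 0)) \<and>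
        \<rho> z = 0 \<and> \<Omega> \<inter> U = {x\<in>U. \<rho> x < 0})"

section \<open>Heat kernels\<close>

definition heat_kernel :: "real \<Rightarrow> 'a::euclidean_space \<Rightarrow> 'a \<Rightarrow> real" where
  "heat_kernel t x y =
     (4 * pi * t) powr (- real DIM('a) / 2) * exp (- (norm (x - y))\<^sup>2 / (4 * t))"

text \<open>\<open>v\<close> is the bounded classical solution of the heat equation in \<open>\<Omega>\<close> with initial datum \<open>f\<close>
  and homogeneous Dirichlet boundary conditions. Boundedness matters for unbounded domains only:
  it is what makes the solution unique there.\<close>

definition dirichlet_heat_solution ::
  "'a::euclidean_space set \<Rightarrow> ('a \<Rightarrow> real) \<Rightarrow> (real \<Rightarrow> 'a \<Rightarrow> real) \<Rightarrow> bool" where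
  "dirichlet_heat_solution \<Omega> f v \<longleftrightarrow>
     continuous_on ({0..} \<times> closure \<Omega>) (\<lambda>(t, x). v t x) \<and>
     bounded ((\<lambda>(t, x). v t x) ` ({0..} \<times> closure \<Omega>)) \<and>
     (\<forall>x\<in>\<Omega>. v 0 x = f x) \<and>
     (\<forall>t\<ge>0. \<forall>x\<in>frontier \<Omega>. v t x = 0) \<and>
     (\<forall>t>0. Ck_on 2 (v t) \<Omega>) \<and>
     (\<forall>t>0. \<forall>x\<in>\<Omega>. ((\<lambda>\<tau>. v \<tau> x) has_real_derivative laplacian (v t) x) (at t))"

definition heat_semigroup ::
  "'a::euclidean_space set \<Rightarrow> (real \<Rightarrow> 'a \<Rightarrow> 'a \<Rightarrow> real) \<Rightarrow> real \<Rightarrow> ('a \<Rightarrow> real) \<Rightarrow> 'a \<Rightarrow> real" where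
  "heat_semigroup \<Omega> K t f x = (LINT y:\<Omega>|lborel. K t x y * f y)"

text \<open>The Dirichlet heat kernel is the continuous integral kernel of the Dirichlet heat semigroup.
  Initial data in \<open>C\<^sub>c(\<Omega>)\<close> determine it uniquely on \<open>(0,\<infinity>) \<times> \<Omega> \<times> \<Omega>\<close>.\<close>

definition dirichlet_heat_kernel ::
  "'a::euclidean_space set \<Rightarrow> (real \<Rightarrow> 'a \<Rightarrow> 'a \<Rightarrow> real) \<Rightarrow> bool" where
  "dirichlet_heat_kernel \<Omega> K \<longleftrightarrow>
     continuous_on ({0<..} \<times> \<Omega> \<times> \<Omega>) (\<lambda>(t, x, y). K t x y) \<and>
     (\<forall>f C. continuous_on UNIV f \<and> compact C \<and> C \<subseteq> \<Omega> \<and> (\<forall>x. x \<notin> C \<longrightarrow> f x = 0) \<longrightarrow>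
        (\<exists>v. dirichlet_heat_solution \<Omega> f v \<and>
             (\<forall>t>0. \<forall>x\<in>\<Omega>. v t x = heat_semigroup \<Omega> K t f x)))"

section \<open>The two operators\<close>

definition Phi :: "real \<Rightarrow> real \<Rightarrow> real" where
  "Phi p t = \<bar>t\<bar> powr (p - 2) * t"

text \<open>The Bochner integral is \<open>0\<close> for non-integrable functions, and \<open>Lim\<close> is unspecified for
  divergent ones. Each operator therefore comes with a predicate stating that its defining
  expression converges to a finite value.\<close>

definition frac_p_laplacian_trunc ::
  "real \<Rightarrow> real \<Rightarrow> real \<Rightarrow> ('a::euclidean_space \<Rightarrow> real) \<Rightarrow> 'a \<Rightarrow> real \<Rightarrow> real" where
  "frac_p_laplacian_trunc C1 s p u x \<epsilon> =
     C1 * (LINT y:{y. norm (x - y) > \<epsilon>}|lborel.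
             Phi p (u x - u y) / norm (x - y) powr (real DIM('a) + s * p))"

definition frac_p_laplacian_trunc_defined ::
  "real \<Rightarrow> real \<Rightarrow> ('a::euclidean_space \<Rightarrow> real) \<Rightarrow> 'a \<Rightarrow> real \<Rightarrow> bool" where
  "frac_p_laplacian_trunc_defined s p u x \<epsilon> \<longleftrightarrow>
     set_integrable lborel {y. norm (x - y) > \<epsilon>}
       (\<lambda>y. Phi p (u x - u y) / norm (x - y) powr (real DIM('a) + s * p))"

definition frac_p_laplacian ::
  "real \<Rightarrow> real \<Rightarrow> real \<Rightarrow> ('a::euclidean_space \<Rightarrow> real) \<Rightarrow> 'a \<Rightarrow> real" where
  "frac_p_laplacian C1 s p u x = Lim (at_right 0) (frac_p_laplacian_trunc C1 s p u x)"

definition frac_p_laplacian_defined ::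
  "real \<Rightarrow> real \<Rightarrow> real \<Rightarrow> ('a::euclidean_space \<Rightarrow> real) \<Rightarrow> 'a \<Rightarrow> bool" where
  "frac_p_laplacian_defined C1 s p u x \<longleftrightarrow>
     (\<forall>\<epsilon>>0. frac_p_laplacian_trunc_defined s p u x \<epsilon>) \<and>
     (\<exists>L. (frac_p_laplacian_trunc C1 s p u x \<longlongrightarrow> L) (at_right 0))"

definition C2_const :: "nat \<Rightarrow> real \<Rightarrow> real \<Rightarrow> real \<Rightarrow> real" where
  "C2_const n C1 s p =
     pi powr (real n / 2) * C1 / (2 powr (s * p) * Gamma ((real n + s * p) / 2))"

definition iterated_integrable ::
  "real \<Rightarrow> real \<Rightarrow> 'a::euclidean_space set \<Rightarrow> (real \<Rightarrow> 'a \<Rightarrow> real) \<Rightarrow> bool" where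
  "iterated_integrable s p A F \<longleftrightarrow>
     (\<forall>t>0. set_integrable lborel A (F t)) \<and>
     set_integrable lborel {0<..} (\<lambda>t. (LINT y:A|lborel. F t y) / t powr (1 + s * p / 2))"

definition spec_p_laplacian ::
  "real \<Rightarrow> real \<Rightarrow> real \<Rightarrow> 'a::euclidean_space set \<Rightarrow> (real \<Rightarrow> 'a \<Rightarrow> 'a \<Rightarrow> real) \<Rightarrow>
   ('a \<Rightarrow> real) \<Rightarrow> 'a \<Rightarrow> real" where
  "spec_p_laplacian C1 s p \<Omega> K u x =
     C2_const DIM('a) C1 s p *
     (LINT t:{0<..}|lborel.
        heat_semigroup \<Omega> K t (\<lambda>y. Phi p (u x - u y)) x / t powr (1 + s * p / 2))"

definition spec_p_laplacian_defined ::
  "real \<Rightarrow> real \<Rightarrow> 'a::euclidean_space set \<Rightarrow> (real \<Rightarrow> 'a \<Rightarrow> 'a \<Rightarrow> real) \<Rightarrow>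
   ('a \<Rightarrow> real) \<Rightarrow> 'a \<Rightarrow> bool" where
  "spec_p_laplacian_defined s p \<Omega> K u x \<longleftrightarrow>
     iterated_integrable s p \<Omega> (\<lambda>t y. K t x y * Phi p (u x - u y))"

text \<open>The spectral-type operator with the same spatial truncation as in the principal value. At
  \<open>p = 2/(2-s)\<close> both operators can diverge to \<open>+\<infinity>\<close> at a critical point of a smooth function
  (the principal value then has a logarithmic divergence); their difference makes sense there
  only as the limit of the differences of the truncations.\<close>

definition spec_p_laplacian_trunc ::
  "real \<Rightarrow> real \<Rightarrow> real \<Rightarrow> 'a::euclidean_space set \<Rightarrow> (real \<Rightarrow> 'a \<Rightarrow> 'a \<Rightarrow> real) \<Rightarrow>
   ('a \<Rightarrow> real) \<Rightarrow> 'a \<Rightarrow> real \<Rightarrow> real" where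
  "spec_p_laplacian_trunc C1 s p \<Omega> K u x \<epsilon> =
     C2_const DIM('a) C1 s p *
     (LINT t:{0<..}|lborel.
        (LINT y:\<Omega> \<inter> {y. norm (x - y) > \<epsilon>}|lborel. K t x y * Phi p (u x - u y))
          / t powr (1 + s * p / 2))"

definition spec_p_laplacian_trunc_defined ::
  "real \<Rightarrow> real \<Rightarrow> 'a::euclidean_space set \<Rightarrow> (real \<Rightarrow> 'a \<Rightarrow> 'a \<Rightarrow> real) \<Rightarrow>
   ('a \<Rightarrow> real) \<Rightarrow> 'a \<Rightarrow> real \<Rightarrow> bool" where
  "spec_p_laplacian_trunc_defined s p \<Omega> K u x \<epsilon> \<longleftrightarrow>
     iterated_integrable s p (\<Omega> \<inter> {y. norm (x - y) > \<epsilon>}) (\<lambda>t y. K t x y * Phi p (u x - u y))"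

end

theory Submission
  imports Defs "HOL-Probability.Distributions"
begin

text \<open>Euler's integral writes \<open>|y|\<close> to the power \<open>-n - sp\<close> as a time integral of the heat kernel, so
  both operators at the origin are integrals over time and space, with kernels \<open>H\<close> and \<open>K\<close>, of the
  same nonnegative function \<open>g y = \<Phi>\<^sub>p (u 0 - u y)\<close>. The parabolic minimum principle gives
  \<open>0 \<le> K \<le> H\<close>, and \<open>H - K = O(t\<^sup>q)\<close> near the origin for every \<open>q\<close>; hence \<open>\<integral>\<integral> (H - K) g\<close> always
  converges, although \<open>\<integral>\<integral> H g\<close> may not. The right-hand side is positive because the complement of a
  smooth domain other than the whole space has positive measure and \<open>g\<close> is positive there.

  The operators are finite when \<open>g\<close> vanishes fast enough at the origin. For \<open>u\<close> itself this can fail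
  at the endpoint \<open>p = 2/(2-s)\<close>; the function \<open>v = u (2 u(0) - u)\<close> is flatter there, as
  \<open>v(0) - v = (u(0) - u)\<^sup>2\<close>, and separates the operators for every \<open>p\<close>.\<close>

section \<open>The heat kernel\<close>

lemma powr_times_exp_bounded:
  fixes a :: real
  assumes "0 \<le> a"
  obtains C where "0 < C" "\<And>x. 0 \<le> x \<Longrightarrow> x powr a * exp (- x) \<le> C"
proof
  define N where "N = nat \<lceil>a\<rceil>"
  have aN: "a \<le> real N" unfolding N_def by linarith
  show "0 < 1 + (fact N :: real)" by (simp add: add_pos_pos)
  fix x :: real assume x: "0 \<le> x"
  have "(\<Sum>n\<in>{N}. x ^ n /\<^sub>R fact n) \<le> (\<Sum>n. x ^ n /\<^sub>R fact n)"
    by (rule sum_le_suminf[OF summable_exp_generic]) (use x in auto)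
  also have "\<dots> = exp x" unfolding exp_def ..
  finally have "x ^ N / fact N \<le> exp x"
    by (simp add: divide_inverse mult.commute)
  then have 1: "x ^ N \<le> fact N * exp x"
    using pos_divide_le_eq[of "fact N" "x ^ N" "exp x"] by (simp only: fact_gt_zero mult.commute)
  have 2: "x powr a \<le> 1 + x ^ N"
  proof (cases "x \<le> 1")
    case True
    then have "x powr a \<le> 1" using assms x powr_le1[of a x] by simp
    moreover have "0 \<le> x ^ N" using x by simp
    ultimately show ?thesis by linarith
  next
    case False
    then have "x powr a \<le> x powr real N" using aN by (intro powr_mono) auto
    then show ?thesis using False by (simp add: powr_realpow)
  qed
  have "1 \<le> exp x" using x by simp
  then have "x powr a \<le> (1 + fact N) * exp x"
    using 1 2 unfolding distrib_right by linarith
  then show "x powr a * exp (- x) \<le> 1 + fact N"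
    using pos_divide_le_eq[of "exp x" "x powr a" "1 + fact N"] by (simp add: exp_minus divide_inverse)
qed

lemma heat_kernel_pos: "0 < t \<Longrightarrow> 0 < heat_kernel t x y"
  by (simp add: heat_kernel_def)

lemma heat_kernel_commute: "heat_kernel t x y = heat_kernel t y x"
  by (simp add: heat_kernel_def norm_minus_commute)

lemma measurable_heat_kernel [measurable (raw)]:
  assumes [measurable]: "f \<in> borel_measurable M" "g \<in> borel_measurable M"
  shows "(\<lambda>w. heat_kernel (f w) x (g w)) \<in> borel_measurable M"
  unfolding heat_kernel_def by measurable

lemma heat_kernel_eq_prod_normal_density:
  fixes x y :: "'a::euclidean_space"
  assumes "0 < t"
  shows "heat_kernel t x y = (\<Prod>b\<in>Basis. normal_density (x \<bullet> b) (sqrt (2 * t)) (y \<bullet> b))"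
proof -
  have n: "(norm (x - y))\<^sup>2 = (\<Sum>b\<in>Basis. (y \<bullet> b - x \<bullet> b)\<^sup>2)"
    unfolding power2_norm_eq_inner
    by (subst euclidean_inner, intro sum.cong refl) (simp only: inner_diff_left power2_eq_square, algebra)
  have "(4 * pi * t) powr (- real DIM('a) / 2) = (1 / sqrt (4 * pi * t)) ^ DIM('a)"
  proof -
    have "(4 * pi * t) powr (- real DIM('a) / 2) = ((4 * pi * t) powr (- 1 / 2)) powr real DIM('a)"
      by (simp only: powr_powr) simp
    also have "(4 * pi * t) powr (- 1 / 2) = 1 / sqrt (4 * pi * t)"
      using assms by (simp add: powr_minus_divide powr_half_sqrt)
    finally show ?thesis using assms by (simp add: powr_realpow)
  qed
  moreover have "(\<Prod>b\<in>Basis. normal_density (x \<bullet> b) (sqrt (2 * t)) (y \<bullet> b))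
     = (\<Prod>b\<in>(Basis::'a set). 1 / sqrt (4 * pi * t)) * (\<Prod>b\<in>Basis. exp (- (y \<bullet> b - x \<bullet> b)\<^sup>2 / (4 * t)))"
    unfolding prod.distrib[symmetric] using assms by (intro prod.cong) (auto simp: normal_density_def)
  moreover have "(\<Prod>b\<in>Basis. exp (- (y \<bullet> b - x \<bullet> b)\<^sup>2 / (4 * t))) = exp (- (norm (x - y))\<^sup>2 / (4 * t))"
    unfolding n by (subst exp_sum[symmetric]) (simp_all add: sum_negf sum_divide_distrib)
  ultimately show ?thesis
    by (simp add: heat_kernel_def)
qed

lemma nn_integral_heat_kernel:
  fixes x :: "'a::euclidean_space"
  assumes "0 < t"
  shows "(\<integral>\<^sup>+y. ennreal (heat_kernel t x y) \<partial>lborel) = 1"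
proof -
  have 1: "(\<integral>\<^sup>+z. ennreal (normal_density m (sqrt (2 * t)) z) \<partial>lborel) = 1" for m
    using assms by (subst nn_integral_eq_integral) auto
  have "(\<integral>\<^sup>+y. ennreal (heat_kernel t x y) \<partial>lborel)
      = (\<integral>\<^sup>+y. (\<Prod>b\<in>Basis. ennreal (normal_density (x \<bullet> b) (sqrt (2 * t)) (y \<bullet> b))) \<partial>lborel)"
    using assms by (simp add: heat_kernel_eq_prod_normal_density prod_ennreal)
  also have "\<dots> = 1"
    by (subst nn_integral_lborel_prod) (simp_all add: 1)
  finally show ?thesis .
qed

lemma heat_kernel_integrable: "0 < t \<Longrightarrow> integrable lborel (heat_kernel t x)"
  using nn_integral_heat_kernel[of t x]
  by (intro integrableI_bounded) (auto simp: heat_kernel_pos less_imp_le)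

lemma heat_kernel_integral: "0 < t \<Longrightarrow> (\<integral>y. heat_kernel t x y \<partial>lborel) = 1"
  using nn_integral_heat_kernel[of t x] heat_kernel_integrable[of t x]
  by (subst integral_eq_nn_integral) (auto simp: heat_kernel_pos less_imp_le)

lemma heat_kernel_decay:
  fixes q :: real
  assumes "0 \<le> q"
  obtains C where "0 < C"
    "\<And>t (x::'a::euclidean_space) y. 0 < t \<Longrightarrow>
       heat_kernel t x y * norm (x - y) powr (real DIM('a) + 2 * q) \<le> C * t powr q"
proof -
  define n where "n = real DIM('a)"
  obtain C where C: "0 < C" "\<And>z. 0 \<le> z \<Longrightarrow> z powr (n / 2 + q) * exp (- z) \<le> C"
    using powr_times_exp_bounded[of "n / 2 + q"] assms by (auto simp: n_def)
  define D where "D = pi powr (- n / 2) * 4 powr q * C"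
  have "heat_kernel t x y * norm (x - y) powr (n + 2 * q) \<le> D * t powr q"
    if t: "0 < t" for t and x y :: 'a
  proof (cases "x = y")
    case True
    then show ?thesis using C by (simp add: D_def n_def)
  next
    case False
    define z where "z = (norm (x - y))\<^sup>2 / (4 * t)"
    have z: "0 < z" using t False by (simp add: z_def)
    have "norm (x - y) powr (n + 2 * q) = ((norm (x - y))\<^sup>2) powr (n / 2 + q)"
      using False by (simp add: powr_powr powr_numeral[symmetric] algebra_simps del: powr_numeral)
    also have "(norm (x - y))\<^sup>2 = 4 * t * z" using t by (simp add: z_def)
    also have "(4 * t * z) powr (n / 2 + q) = (4 * t) powr (n / 2) * (4 * t) powr q * z powr (n / 2 + q)"
      using t z by (simp add: powr_mult powr_add)
    finally have "heat_kernel t x y * norm (x - y) powr (n + 2 * q)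
       = (4 * t * pi) powr (- n / 2) * (4 * t) powr (n / 2) * (4 * t) powr q * (z powr (n / 2 + q) * exp (- z))"
      by (simp add: heat_kernel_def z_def n_def mult.commute mult.left_commute mult.assoc)
    also have "(4 * t * pi) powr (- n / 2) * (4 * t) powr (n / 2) = pi powr (- n / 2)"
      using t powr_add[of "4 * t" "- n / 2" "n / 2"] by (simp add: powr_mult)
    also have "(4 * t) powr q = 4 powr q * t powr q" using t by (simp add: powr_mult)
    finally have "heat_kernel t x y * norm (x - y) powr (n + 2 * q)
       = pi powr (- n / 2) * 4 powr q * t powr q * (z powr (n / 2 + q) * exp (- z))"
      by (simp add: mult.assoc)
    also have "\<dots> \<le> pi powr (- n / 2) * 4 powr q * t powr q * C"
      using C(2)[of z] z by (intro mult_left_mono) auto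
    finally show ?thesis by (simp add: D_def mult_ac)
  qed
  moreover have "0 < D" using C by (simp add: D_def)
  ultimately show ?thesis using that unfolding n_def by blast
qed

lemma heat_kernel_moment:
  fixes a :: real
  assumes "0 \<le> a"
  obtains C where "0 < C"
    "\<And>t (x::'a::euclidean_space). 0 < t \<Longrightarrow>
       (\<integral>\<^sup>+y. ennreal (heat_kernel t x y * norm (x - y) powr (2 * a)) \<partial>lborel) \<le> ennreal (C * t powr a)"
proof -
  define n where "n = real DIM('a)"
  obtain C where C: "0 < C" "\<And>z. 0 \<le> z \<Longrightarrow> z powr a * exp (- z) \<le> C"
    using powr_times_exp_bounded[of a] assms by auto
  define D where "D = 2 powr (n / 2) * 8 powr a * C"
  have D: "0 < D" using C by (simp add: D_def)
  have *: "heat_kernel t x y * norm (x - y) powr (2 * a) \<le> D * t powr a * heat_kernel (2 * t) x y"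
    if t: "0 < t" for t and x y :: 'a
  proof (cases "x = y")
    case True
    then show ?thesis using D by (simp add: less_imp_le heat_kernel_def)
  next
    case False
    define z where "z = (norm (x - y))\<^sup>2 / (8 * t)"
    have z: "0 < z" using t False by (simp add: z_def)
    have "norm (x - y) powr (2 * a) = ((norm (x - y))\<^sup>2) powr a"
      using False by (simp add: powr_powr powr_numeral[symmetric] algebra_simps del: powr_numeral)
    also have "(norm (x - y))\<^sup>2 = 8 * t * z" using t by (simp add: z_def)
    also have "(8 * t * z) powr a = 8 powr a * t powr a * z powr a"
      using t z by (simp add: powr_mult)
    finally have 1: "norm (x - y) powr (2 * a) = 8 powr a * t powr a * z powr a" .
    have 2: "(4 * pi * t) powr (- n / 2) = 2 powr (n / 2) * (4 * pi * (2 * t)) powr (- n / 2)"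
      using t powr_add[of 2 "- n / 2" "n / 2"]
        powr_mult[of 2 "4 * pi * t" "- n / 2"] by (simp add: mult_ac)
    have "- (norm (x - y))\<^sup>2 / (4 * t) = - z + - z" using t by (simp add: z_def)
    then have "heat_kernel t x y = (4 * pi * t) powr (- n / 2) * (exp (- z) * exp (- z))"
      unfolding exp_add[symmetric] by (simp only: heat_kernel_def n_def)
    also have "\<dots> = 2 powr (n / 2) * ((4 * pi * (2 * t)) powr (- n / 2) * exp (- z)) * exp (- z)"
      unfolding 2 by (simp only: mult_ac)
    also have "(4 * pi * (2 * t)) powr (- n / 2) * exp (- z) = heat_kernel (2 * t) x y"
      using t by (simp add: heat_kernel_def n_def z_def)
    finally have "heat_kernel t x y * norm (x - y) powr (2 * a)
       = (2 powr (n / 2) * 8 powr a * t powr a * heat_kernel (2 * t) x y) * (z powr a * exp (- z))"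
      unfolding 1 by (simp only: mult_ac)
    also have "\<dots> \<le> (2 powr (n / 2) * 8 powr a * t powr a * heat_kernel (2 * t) x y) * C"
      using C(2)[of z] z t heat_kernel_pos[of "2 * t" x y] by (intro mult_left_mono) auto
    finally show ?thesis by (simp add: D_def mult_ac)
  qed
  have "(\<integral>\<^sup>+y. ennreal (heat_kernel t x y * norm (x - y) powr (2 * a)) \<partial>lborel) \<le> ennreal (D * t powr a)"
    if t: "0 < t" for t and x :: 'a
  proof -
    have "(\<integral>\<^sup>+y. ennreal (heat_kernel t x y * norm (x - y) powr (2 * a)) \<partial>lborel)
       \<le> (\<integral>\<^sup>+y. ennreal (D * t powr a) * ennreal (heat_kernel (2 * t) x y) \<partial>lborel)"
      using *[OF t, of x] D t by (intro nn_integral_mono) (simp add: ennreal_mult'[symmetric] ennreal_leI)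
    also have "\<dots> = ennreal (D * t powr a)"
      using nn_integral_heat_kernel[of "2 * t" x] t by (subst nn_integral_cmult) auto
    finally show ?thesis .
  qed
  then show ?thesis using that D by blast
qed

text \<open>Substitute \<open>\<tau> = |x - y|\<^sup>2 / (4 t)\<close> to reach Euler's integral.\<close>

lemma heat_kernel_time_integral:
  fixes x y :: "'a::euclidean_space"
  assumes \<sigma>: "0 < \<sigma>" and xy: "x \<noteq> y"
  shows "has_bochner_integral lborel
     (\<lambda>t. indicator {0<..} t * (heat_kernel t x y / t powr (1 + \<sigma> / 2)))
     (pi powr (- real DIM('a) / 2) * 2 powr \<sigma> * Gamma ((real DIM('a) + \<sigma>) / 2)
        / norm (x - y) powr (real DIM('a) + \<sigma>))"
proof -
  define n where "n = real DIM('a)"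
  define r where "r = norm (x - y)"
  define c where "c = r\<^sup>2 / 4"
  define \<gamma> where "\<gamma> = (n + \<sigma>) / 2"
  have r: "0 < r" and c: "0 < c" and \<gamma>: "0 < \<gamma>" and n: "0 < n"
    using xy \<sigma> by (auto simp: r_def c_def \<gamma>_def n_def add_pos_pos)
  define f where "f = (\<lambda>\<tau>::real. \<tau> powr (\<gamma> - 1) / exp \<tau>)"
  have f_int: "(f has_integral Gamma \<gamma>) {0<..}"
  proof (rule has_integral_spike_set_eq[THEN iffD1, OF _ _ Gamma_integral_real[OF \<gamma>, folded f_def]])
    show "negligible {\<tau> \<in> {0..} - {0<..}. f \<tau> \<noteq> 0}"
      by (rule negligible_subset[of "{0}"]) auto
    show "negligible {\<tau> \<in> {0<..} - {0..}. f \<tau> \<noteq> 0}"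
      by (rule negligible_subset[of "{0}"]) auto
  qed
  have f_abs: "f absolutely_integrable_on {0<..}"
    using f_int by (intro nonnegative_absolutely_integrable_1) (auto simp: f_def has_integral_iff)
  have img: "(\<lambda>t. c / t) ` {0<..} = {0<..}"
  proof safe
    fix t :: real assume "0 < t"
    then show "0 < c / t" using c by simp
  next
    fix t :: real assume "0 < t"
    then show "t \<in> (\<lambda>t. c / t) ` {0<..}" using c by (intro image_eqI[of _ _ "c / t"]) auto
  qed
  let ?g = "\<lambda>t. \<bar>- c / t\<^sup>2\<bar> * f (c / t)"
  have "?g absolutely_integrable_on {0<..} \<and> integral {0<..} ?g = Gamma \<gamma>"
  proof (rule has_absolute_integral_change_of_variables_1'[where g = "\<lambda>t. c / t" and g' = "\<lambda>t. - c / t\<^sup>2" and f = f, THEN iffD2])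
    show "((\<lambda>t. c / t) has_field_derivative - c / t\<^sup>2) (at t within {0<..})" if "t \<in> {0<..}" for t
      using that by (auto intro!: derivative_eq_intros simp: power2_eq_square)
    show "inj_on (\<lambda>t. c / t) {0<..}" using c by (auto simp: inj_on_def)
    show "f absolutely_integrable_on (\<lambda>t. c / t) ` {0<..} \<and>
        integral ((\<lambda>t. c / t) ` {0<..}) f = Gamma \<gamma>"
      unfolding img using f_abs integral_unique[OF f_int] by simp
  qed simp
  then have g: "set_integrable lebesgue {0<..} ?g" "(LINT t:{0<..}|lebesgue. ?g t) = Gamma \<gamma>"
    by (auto simp: set_lebesgue_integral_eq_integral)
  define A where "A = (4 * pi) powr (- n / 2) * c powr (- \<gamma>)"
  have eq: "heat_kernel t x y / t powr (1 + \<sigma> / 2) = A * ?g t" if t: "0 < t" for t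
  proof -
    have "?g t = c / t\<^sup>2 * ((c / t) powr (\<gamma> - 1) * exp (- (c / t)))"
      using c t by (simp add: f_def exp_minus field_simps)
    also have "(c / t) powr (\<gamma> - 1) = (c powr \<gamma> / c) * (t / t powr \<gamma>)"
      using c t by (simp add: powr_diff powr_divide)
    finally have "A * ?g t = (4 * pi) powr (- n / 2) * (c powr (- \<gamma>) * c powr \<gamma>) * (1 / (t * t powr \<gamma>)) * exp (- (c / t))"
      using c t by (simp add: A_def power2_eq_square field_simps)
    also have "c powr (- \<gamma>) * c powr \<gamma> = 1" using c by (simp add: powr_add[symmetric])
    also have "1 / (t * t powr \<gamma>) = t powr (- n / 2) / t powr (1 + \<sigma> / 2)"
    proof -
      have "t powr (- n / 2) / t powr (1 + \<sigma> / 2) = t powr (- n / 2 - (1 + \<sigma> / 2))"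
        by (simp only: powr_diff)
      also have "- n / 2 - (1 + \<sigma> / 2) = - (1 + \<gamma>)" by (simp add: \<gamma>_def field_simps)
      also have "t powr \<dots> = 1 / (t * t powr \<gamma>)"
        using t by (simp add: powr_diff powr_minus_divide)
      finally show ?thesis by simp
    qed
    finally show ?thesis
      using t by (simp add: heat_kernel_def powr_mult c_def r_def n_def mult_ac)
  qed
  define h where "h = (\<lambda>t. heat_kernel t x y / t powr (1 + \<sigma> / 2))"
  define g where "g = ?g"
  have g: "set_integrable lebesgue {0<..} (\<lambda>t. A * g t)" "(LINT t:{0<..}|lebesgue. A * g t) = A * Gamma \<gamma>"
    using g unfolding g_def[symmetric] by (simp_all add: set_integrable_mult_right)
  have "set_integrable lebesgue {0<..} h"
    by (rule set_integrable_cong[THEN iffD2, OF refl refl _ g(1)]) (use eq in \<open>simp add: h_def g_def\<close>)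
  moreover have "(LINT t:{0<..}|lebesgue. h t) = A * Gamma \<gamma>"
    unfolding g(2)[symmetric]
    by (rule set_lebesgue_integral_cong) (use eq in \<open>simp_all add: h_def g_def\<close>)
  moreover have "(\<lambda>t. indicator {0<..} t * h t) \<in> borel_measurable borel"
    unfolding h_def by measurable
  ultimately have "has_bochner_integral lborel (\<lambda>t. indicator {0<..} t * h t) (A * Gamma \<gamma>)"
    unfolding set_integrable_def set_lebesgue_integral_def has_bochner_integral_iff
    by (simp add: integrable_completion integral_completion)
  moreover have "A = pi powr (- n / 2) * 2 powr \<sigma> / r powr (n + \<sigma>)"
  proof -
    have "c = (r / 2) powr 2" using r by (simp add: c_def power_divide)
    then have "c powr (- \<gamma>) = (r / 2) powr (2 * - \<gamma>)"
      by (simp only: powr_powr)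
    also have "2 * - \<gamma> = - (n + \<sigma>)" by (simp add: \<gamma>_def field_simps)
    also have "(r / 2) powr (- (n + \<sigma>)) = 1 / ((r / 2) powr (n + \<sigma>))"
      by (rule powr_minus_divide)
    also have "\<dots> = 2 powr (n + \<sigma>) / r powr (n + \<sigma>)"
      using r by (simp add: powr_divide)
    also have "2 powr (n + \<sigma>) = 2 powr n * 2 powr \<sigma>" by (rule powr_add)
    finally have 1: "c powr (- \<gamma>) = 2 powr n * 2 powr \<sigma> / r powr (n + \<sigma>)" .
    have "4 powr (- n / 2) = (2::real) powr (- n)"
      using powr_powr[of 2 2 "- n / 2"] by simp
    then have 2: "(4 * pi) powr (- n / 2) = pi powr (- n / 2) / 2 powr n"
      using powr_minus_divide[of 2 n] by (simp add: powr_mult)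
    show ?thesis unfolding A_def 1 2 by simp
  qed
  ultimately show ?thesis
    by (simp add: n_def \<gamma>_def r_def h_def)
qed

section \<open>The parabolic minimum principle\<close>

lemma second_derivative_nonneg_at_minimum:
  fixes f f' :: "real \<Rightarrow> real"
  assumes d: "0 < d"
    and f: "\<And>r. \<bar>r\<bar> < d \<Longrightarrow> (f has_real_derivative f' r) (at r)"
    and f': "(f' has_real_derivative c) (at 0)"
    and min: "\<And>r. \<bar>r\<bar> < d \<Longrightarrow> f 0 \<le> f r"
  shows "0 \<le> c"
proof (rule ccontr)
  assume "\<not> 0 \<le> c"
  have f'0: "f' 0 = 0"
    using DERIV_local_min[OF f d] min d by auto
  obtain e where e: "0 < e" "\<And>h. 0 < h \<Longrightarrow> h < e \<Longrightarrow> f' (0 + h) < f' 0"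
    using DERIV_neg_dec_right[OF f'] \<open>\<not> 0 \<le> c\<close> by force
  define h where "h = min d e / 2"
  have h: "0 < h" "h < d" "h < e" using d e by (auto simp: h_def)
  obtain z where z: "0 < z" "z < h" "f h - f 0 = (h - 0) * f' z"
    using MVT2[of 0 h f f'] h f by force
  have "h * f' z < 0" using e(2)[of z] z h f'0 by (intro mult_pos_neg) auto
  then show False using min[of h] h z by simp
qed

text \<open>Only derivatives along the coordinate axes are recorded: this suffices for the maximum
  principle and is stable under differences by rules of one-variable calculus.\<close>

definition caloric_with ::
  "'a::euclidean_space set \<Rightarrow> (real \<Rightarrow> 'a \<Rightarrow> real) \<Rightarrow> (real \<Rightarrow> 'a \<Rightarrow> 'a \<Rightarrow> real) \<Rightarrow>
   (real \<Rightarrow> 'a \<Rightarrow> 'a \<Rightarrow> real) \<Rightarrow> bool" where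
  "caloric_with \<Omega> w D1 D2 \<longleftrightarrow> (\<forall>t>0. \<forall>x\<in>\<Omega>.
     (\<forall>i\<in>Basis. ((\<lambda>r. w t (x + r *\<^sub>R i)) has_real_derivative D1 t i x) (at 0) \<and>
                ((\<lambda>r. D1 t i (x + r *\<^sub>R i)) has_real_derivative D2 t i x) (at 0)) \<and>
     ((\<lambda>\<tau>. w \<tau> x) has_real_derivative (\<Sum>i\<in>Basis. D2 t i x)) (at t))"

definition caloric :: "'a::euclidean_space set \<Rightarrow> (real \<Rightarrow> 'a \<Rightarrow> real) \<Rightarrow> bool" where
  "caloric \<Omega> w \<longleftrightarrow> (\<exists>D1 D2. caloric_with \<Omega> w D1 D2)"

lemma caloric_withD:
  assumes "caloric_with \<Omega> w D1 D2" "0 < t" "x \<in> \<Omega>"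
  shows "i \<in> Basis \<Longrightarrow> ((\<lambda>r. w t (x + r *\<^sub>R i)) has_real_derivative D1 t i x) (at 0)"
    and "i \<in> Basis \<Longrightarrow> ((\<lambda>r. D1 t i (x + r *\<^sub>R i)) has_real_derivative D2 t i x) (at 0)"
    and "((\<lambda>\<tau>. w \<tau> x) has_real_derivative (\<Sum>i\<in>Basis. D2 t i x)) (at t)"
  using assms by (auto simp: caloric_with_def)

lemma caloric_diff:
  assumes "caloric \<Omega> v" "caloric \<Omega> w"
  shows "caloric \<Omega> (\<lambda>t x. v t x - w t x)"
proof -
  from assms obtain D1 D2 E1 E2 where
    D: "caloric_with \<Omega> v D1 D2" and E: "caloric_with \<Omega> w E1 E2"
    unfolding caloric_def by blast
  have "caloric_with \<Omega> (\<lambda>t x. v t x - w t x) (\<lambda>t i x. D1 t i x - E1 t i x) (\<lambda>t i x. D2 t i x - E2 t i x)"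
    unfolding caloric_with_def sum_subtractf
    using caloric_withD[OF D] caloric_withD[OF E] by (intro allI ballI impI conjI DERIV_diff)
  then show ?thesis unfolding caloric_def by blast
qed

lemma dirichlet_heat_solution_caloric:
  fixes \<Omega> :: "'a::euclidean_space set"
  assumes v: "dirichlet_heat_solution \<Omega> f v"
  shows "caloric \<Omega> v"
proof -
  have line: "((\<lambda>r. g (x + r *\<^sub>R i)) has_real_derivative frechet_derivative g (at x) i) (at 0)"
    if g: "g differentiable (at x)" for g :: "'a \<Rightarrow> real" and x i
  proof -
    have "(g has_derivative frechet_derivative g (at x)) (at (x + 0 *\<^sub>R i))"
      using g frechet_derivative_works by force
    then have "(g \<circ> (\<lambda>r. x + r *\<^sub>R i) has_derivative frechet_derivative g (at x) \<circ> (\<lambda>r. r *\<^sub>R i)) (at 0)"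
      by (intro diff_chain_at) (auto intro!: derivative_eq_intros)
    moreover have "frechet_derivative g (at x) (r *\<^sub>R i) = r * frechet_derivative g (at x) i" for r
      using linear_cmul[OF linear_frechet_derivative[OF g]] by simp
    ultimately show ?thesis
      by (simp add: has_field_derivative_def o_def mult_commute_abs)
  qed
  have "Ck_on (Suc (Suc 0)) (v t) \<Omega>" if "0 < t" for t
    using v that by (simp only: dirichlet_heat_solution_def numeral_2_eq_2)
  moreover have "((\<lambda>\<tau>. v \<tau> x) has_real_derivative laplacian (v t) x) (at t)" if "0 < t" "x \<in> \<Omega>" for t x
    using v that by (simp add: dirichlet_heat_solution_def)
  ultimately show ?thesis
    unfolding caloric_def caloric_with_def laplacian_def
    by (intro exI[of _ "\<lambda>t i x. frechet_derivative (v t) (at x) i"]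
        exI[of _ "\<lambda>t i x. frechet_derivative (\<lambda>z. frechet_derivative (v t) (at z) i) (at x) i"]
        allI impI ballI conjI line) auto
qed

lemma heat_kernel_caloric:
  fixes y :: "'a::euclidean_space"
  assumes \<tau>: "0 \<le> \<tau>"
  shows "caloric \<Omega> (\<lambda>t x. heat_kernel (t + \<tau>) x y)"
proof -
  define n where "n = real DIM('a)"
  define D1 where "D1 = (\<lambda>t i (x::'a). - ((x - y) \<bullet> i) / (2 * (t + \<tau>)) * heat_kernel (t + \<tau>) x y)"
  define D2 where "D2 = (\<lambda>t i (x::'a).
    (((x - y) \<bullet> i)\<^sup>2 / (4 * (t + \<tau>)\<^sup>2) - 1 / (2 * (t + \<tau>))) * heat_kernel (t + \<tau>) x y)"
  have sq: "(norm (x + r *\<^sub>R i - y))\<^sup>2 = (norm (x - y))\<^sup>2 + 2 * r * ((x - y) \<bullet> i) + r\<^sup>2"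
    if "i \<in> Basis" for x i :: 'a and r
    using that unfolding power2_norm_eq_inner
    by (simp add: inner_diff_left inner_diff_right inner_add_left inner_add_right inner_commute
        inner_Basis power2_eq_square algebra_simps)
  have gauss: "((\<lambda>r. c * exp (- (N + 2 * r * b + r\<^sup>2) / (4 * T))) has_real_derivative
      - b / (2 * T) * (c * exp (- N / (4 * T)))) (at 0)" if "0 < T" for c N b T :: real
    using that by (auto intro!: derivative_eq_intros simp: field_simps)
  have 1: "((\<lambda>r. heat_kernel (t + \<tau>) (x + r *\<^sub>R i) y) has_real_derivative D1 t i x) (at 0)"
    if t: "0 < t" and i: "i \<in> Basis" for t x i
    unfolding heat_kernel_def sq[OF i] D1_def using t \<tau> by (intro gauss) auto
  have 2: "((\<lambda>r. D1 t i (x + r *\<^sub>R i)) has_real_derivative D2 t i x) (at 0)"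
    if t: "0 < t" and i: "i \<in> Basis" for t x i
  proof -
    define b k where "b = (x - y) \<bullet> i" and "k = t + \<tau>"
    have k: "0 < k" using t \<tau> by (simp add: k_def)
    have b: "(x + r *\<^sub>R i - y) \<bullet> i = b + r" for r
      using i by (simp add: b_def inner_add_left inner_diff_left)
    have "((\<lambda>r. - (b + r) / (2 * k)) has_real_derivative - 1 / (2 * k)) (at 0)"
      using k by (auto intro!: derivative_eq_intros)
    from DERIV_mult[OF this 1[OF t i, of x]] show ?thesis
      unfolding D1_def D2_def b b_def[symmetric] k_def[symmetric]
      using k by (elim DERIV_cong) (simp add: b_def[symmetric] power2_eq_square field_simps)
  qed
  have 3: "((\<lambda>t. heat_kernel (t + \<tau>) x y) has_real_derivative (\<Sum>i\<in>Basis. D2 t i x)) (at t)"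
    if t: "0 < t" for t x
  proof -
    define T where "T = t + \<tau>"
    have T: "0 < T" using t \<tau> by (simp add: T_def)
    have N: "(\<Sum>i\<in>Basis. ((x - y) \<bullet> i)\<^sup>2) = (norm (x - y))\<^sup>2"
      unfolding power2_norm_eq_inner by (subst (2) euclidean_inner) (simp add: power2_eq_square)
    have "(\<Sum>i\<in>Basis. D2 t i x) = (\<Sum>i\<in>Basis. ((x - y) \<bullet> i)\<^sup>2 / (4 * T\<^sup>2) - 1 / (2 * T)) * heat_kernel T x y"
      by (simp add: D2_def sum_distrib_right T_def)
    also have "\<dots> = ((norm (x - y))\<^sup>2 / (4 * T\<^sup>2) - n / (2 * T)) * heat_kernel T x y"
      by (simp add: sum_subtractf sum_divide_distrib[symmetric] N n_def)
    finally have sum: "(\<Sum>i\<in>Basis. D2 t i x) = ((norm (x - y))\<^sup>2 / (4 * T\<^sup>2) - n / (2 * T)) * heat_kernel T x y" .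
    have lin: "((\<lambda>T. 4 * pi * T) has_real_derivative 4 * pi) (at T)"
      by (auto intro!: derivative_eq_intros)
    have "((\<lambda>T. (4 * pi * T) powr (- n / 2)) has_real_derivative - n / (2 * T) * (4 * pi * T) powr (- n / 2)) (at T)"
      using T by (intro DERIV_cong[OF DERIV_fun_powr[OF lin]]) (simp_all add: powr_diff)
    moreover have "((\<lambda>T. exp (- (norm (x - y))\<^sup>2 / (4 * T))) has_real_derivative
        (norm (x - y))\<^sup>2 / (4 * T\<^sup>2) * exp (- (norm (x - y))\<^sup>2 / (4 * T))) (at T)"
      using T by (auto intro!: derivative_eq_intros simp: power2_eq_square field_simps)
    ultimately have "((\<lambda>T. heat_kernel T x y) has_real_derivative (\<Sum>i\<in>Basis. D2 t i x)) (at (t + \<tau>))"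
      unfolding sum heat_kernel_def n_def[symmetric] T_def[symmetric]
      by (rule DERIV_cong[OF DERIV_mult]) (simp add: algebra_simps)
    then show ?thesis by (simp add: DERIV_shift)
  qed
  show ?thesis
    unfolding caloric_def caloric_with_def using 1 2 3 by blast
qed

lemma parabolic_minimum_principle:
  fixes \<Omega> :: "'a::euclidean_space set"
  assumes \<Omega>: "open \<Omega>"
    and cont: "continuous_on ({0..} \<times> closure \<Omega>) (\<lambda>(t, x). w t x)"
    and bdd: "\<And>t x. 0 \<le> t \<Longrightarrow> x \<in> closure \<Omega> \<Longrightarrow> B \<le> w t x"
    and heat: "caloric \<Omega> w"
    and init: "\<And>x. x \<in> \<Omega> \<Longrightarrow> m \<le> w 0 x"
    and bdry: "\<And>t x. 0 \<le> t \<Longrightarrow> t \<le> T \<Longrightarrow> x \<in> frontier \<Omega> \<Longrightarrow> m \<le> w t x"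
    and tx: "0 \<le> t" "t \<le> T" "x \<in> closure \<Omega>"
  shows "m \<le> w t x"
proof -
  define n where "n = real DIM('a)"
  obtain D1 D2 where D: "caloric_with \<Omega> w D1 D2"
    using heat unfolding caloric_def by blast
  have barrier: "m \<le> w t x + \<epsilon> * ((norm x)\<^sup>2 + (2 * n + 1) * t)" if \<epsilon>: "0 < \<epsilon>" for \<epsilon>
  proof (rule ccontr)
    define W where "W = (\<lambda>t x. w t x + \<epsilon> * ((norm x)\<^sup>2 + (2 * n + 1) * t))"
    assume "\<not> m \<le> w t x + \<epsilon> * ((norm x)\<^sup>2 + (2 * n + 1) * t)"
    then have neg: "W t x < m" by (simp add: W_def)
    define \<rho> where "\<rho> = max (norm x) (sqrt (max 0 ((m - B) / \<epsilon>)))"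
    have "max 0 ((m - B) / \<epsilon>) \<le> \<rho>\<^sup>2"
      by (rule sqrt_le_D) (simp add: \<rho>_def)
    then have "(m - B) / \<epsilon> \<le> \<rho>\<^sup>2" by simp
    then have \<rho>2: "m \<le> B + \<epsilon> * \<rho>\<^sup>2" using \<epsilon> by (simp add: field_simps)
    define S where "S = {0..T} \<times> (closure \<Omega> \<inter> cball 0 \<rho>)"
    have "compact S"
      unfolding S_def by (intro compact_Times closed_Int_compact) auto
    moreover have "(t, x) \<in> S" using tx by (auto simp: S_def \<rho>_def)
    moreover have "continuous_on S (\<lambda>(t, x). W t x)"
    proof -
      have "continuous_on S (\<lambda>(t, x). w t x)"
        by (rule continuous_on_subset[OF cont]) (auto simp: S_def)
      then show ?thesis
        unfolding W_def case_prod_beta by (intro continuous_intros)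
    qed
    ultimately obtain p where p: "p \<in> S" "\<And>q. q \<in> S \<Longrightarrow> (\<lambda>(t, x). W t x) p \<le> (\<lambda>(t, x). W t x) q"
      using continuous_attains_inf[of S "\<lambda>(t, x). W t x"] by blast
    obtain t0 x0 where p_eq: "p = (t0, x0)" by fastforce
    have t0x0: "0 \<le> t0" "t0 \<le> T" "x0 \<in> closure \<Omega>" "norm x0 \<le> \<rho>"
      using p(1) by (auto simp: p_eq S_def)
    have min: "W t0 x0 \<le> W t' x'" if "0 \<le> t'" "t' \<le> T" "x' \<in> closure \<Omega>" "norm x' \<le> \<rho>" for t' x'
      using p(2)[of "(t', x')"] that by (auto simp: p_eq S_def)
    have Wm: "W t0 x0 < m"
      using min[of t x] tx neg by (auto simp: \<rho>_def)
    have n: "0 \<le> n" by (simp add: n_def)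
    have "0 \<le> \<epsilon> * ((norm x0)\<^sup>2 + (2 * n + 1) * t0)" using \<epsilon> t0x0 n by simp
    then have wm: "w t0 x0 < m" using Wm by (simp add: W_def)
    have x0: "x0 \<in> \<Omega>"
      using bdry[of t0 x0] t0x0 wm \<Omega> by (auto simp: frontier_def interior_open)
    have t0: "0 < t0"
      using init[OF x0] wm t0x0 by (cases "t0 = 0") auto
    have "norm x0 \<noteq> \<rho>"
    proof
      assume "norm x0 = \<rho>"
      moreover have "0 \<le> \<epsilon> * ((2 * n + 1) * t0)" using \<epsilon> t0 n by simp
      ultimately show False
        using Wm \<rho>2 bdd[of t0 x0] t0x0 by (simp add: W_def algebra_simps)
    qed
    then have x0\<rho>: "norm x0 < \<rho>" using t0x0 by simp
    have time: "(\<Sum>i\<in>Basis. D2 t0 i x0) + \<epsilon> * (2 * n + 1) \<le> 0"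
    proof (rule ccontr)
      assume pos: "\<not> (\<Sum>i\<in>Basis. D2 t0 i x0) + \<epsilon> * (2 * n + 1) \<le> 0"
      have "((\<lambda>\<tau>. W \<tau> x0) has_real_derivative (\<Sum>i\<in>Basis. D2 t0 i x0) + \<epsilon> * (2 * n + 1)) (at t0)"
        unfolding W_def by (auto intro!: derivative_eq_intros caloric_withD(3)[OF D t0 x0])
      then obtain d where d: "0 < d" "\<And>h. 0 < h \<Longrightarrow> h < d \<Longrightarrow> W (t0 - h) x0 < W t0 x0"
        using DERIV_pos_inc_left[of "\<lambda>\<tau>. W \<tau> x0"] pos by force
      define h where "h = min d t0 / 2"
      have "0 < h" "h < d" "h < t0" using d t0 by (auto simp: h_def)
      then show False
        using d(2)[of h] min[of "t0 - h" x0] t0x0 by auto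
    qed
    have space: "0 \<le> D2 t0 i x0 + 2 * \<epsilon>" if i: "i \<in> Basis" for i
    proof -
      have "open (\<Omega> \<inter> ball 0 \<rho>)" "x0 \<in> \<Omega> \<inter> ball 0 \<rho>" using \<Omega> x0 x0\<rho> by auto
      then obtain d where d: "0 < d" "ball x0 d \<subseteq> \<Omega> \<inter> ball 0 \<rho>"
        using open_contains_ball by blast
      have in_dom: "x0 + r *\<^sub>R i \<in> \<Omega>" "norm (x0 + r *\<^sub>R i) < \<rho>" if "\<bar>r\<bar> < d" for r
      proof -
        have "x0 + r *\<^sub>R i \<in> ball x0 d" using that i by (simp add: dist_norm)
        then have "x0 + r *\<^sub>R i \<in> \<Omega> \<inter> ball 0 \<rho>" using d(2) by blast
        then show "x0 + r *\<^sub>R i \<in> \<Omega>" "norm (x0 + r *\<^sub>R i) < \<rho>" by simp_all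
      qed
      have sq: "(norm (x0 + r *\<^sub>R i))\<^sup>2 = (norm x0)\<^sup>2 + 2 * r * (x0 \<bullet> i) + r\<^sup>2" for r
        using i unfolding power2_norm_eq_inner
        by (simp add: inner_add_left inner_add_right inner_commute power2_eq_square algebra_simps)
      show ?thesis
      proof (rule second_derivative_nonneg_at_minimum[OF d(1)])
        fix r :: real assume r: "\<bar>r\<bar> < d"
        have "((\<lambda>s. w t0 (x0 + r *\<^sub>R i + s *\<^sub>R i)) has_real_derivative D1 t0 i (x0 + r *\<^sub>R i)) (at 0)"
          by (rule caloric_withD(1)[OF D t0 in_dom(1)[OF r] i])
        then have "((\<lambda>s. w t0 (x0 + s *\<^sub>R i)) has_real_derivative D1 t0 i (x0 + r *\<^sub>R i)) (at (0 + r))"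
          unfolding DERIV_shift by (simp add: scaleR_add_left add_ac)
        then show "((\<lambda>r. W t0 (x0 + r *\<^sub>R i)) has_real_derivative
            D1 t0 i (x0 + r *\<^sub>R i) + \<epsilon> * (2 * (x0 \<bullet> i) + 2 * r)) (at r)"
          unfolding W_def sq by (auto intro!: derivative_eq_intros simp: algebra_simps)
        show "W t0 (x0 + 0 *\<^sub>R i) \<le> W t0 (x0 + r *\<^sub>R i)"
          using min[of t0 "x0 + r *\<^sub>R i"] t0x0 in_dom[OF r] closure_subset by auto
      next
        show "((\<lambda>r. D1 t0 i (x0 + r *\<^sub>R i) + \<epsilon> * (2 * (x0 \<bullet> i) + 2 * r)) has_real_derivative
            D2 t0 i x0 + 2 * \<epsilon>) (at 0)"
          by (auto intro!: derivative_eq_intros caloric_withD(2)[OF D t0 x0 i])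
      qed
    qed
    have "0 \<le> (\<Sum>i\<in>Basis. D2 t0 i x0 + 2 * \<epsilon>)" by (intro sum_nonneg space)
    also have "\<dots> = (\<Sum>i\<in>Basis. D2 t0 i x0) + 2 * n * \<epsilon>" by (simp add: sum.distrib n_def)
    finally show False using time \<epsilon> by (simp add: algebra_simps)
  qed
  have "((\<lambda>\<epsilon>. w t x + \<epsilon> * ((norm x)\<^sup>2 + (2 * n + 1) * t)) \<longlongrightarrow> w t x + 0 * ((norm x)\<^sup>2 + (2 * n + 1) * t))
      (at_right 0)"
    by (intro tendsto_intros)
  then show ?thesis
    using barrier by (intro tendsto_lowerbound[of _ _ "at_right 0"])
      (auto simp: eventually_at_right_less intro!: eventually_at_rightI[of 0 1])
qed

section \<open>Bounds for the Dirichlet heat kernel\<close>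

lemma continuous_on_heat_kernel:
  assumes "continuous_on S f" "continuous_on S g" "\<And>z. z \<in> S \<Longrightarrow> 0 < f z"
  shows "continuous_on S (\<lambda>z. heat_kernel (f z) (g z) y)"
proof -
  have "f z \<noteq> 0" if "z \<in> S" for z using assms(3)[OF that] by simp
  then show ?thesis
    unfolding heat_kernel_def using assms(1,2) by (intro continuous_intros) auto
qed

lemma tendsto_heat_kernel_time:
  assumes "0 < t"
  shows "((\<lambda>\<tau>. heat_kernel (t + \<tau>) x y) \<longlongrightarrow> heat_kernel t x y) (at_right 0)"
proof -
  have "continuous_on {0..} (\<lambda>\<tau>. heat_kernel (t + \<tau>) x y)"
    using assms by (intro continuous_on_heat_kernel continuous_intros) auto
  then have "((\<lambda>\<tau>. heat_kernel (t + \<tau>) x y) \<longlongrightarrow> heat_kernel (t + 0) x y) (at 0 within {0..})"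
    unfolding continuous_on_def by (rule bspec) simp
  then show ?thesis by (auto intro: tendsto_within_subset)
qed

lemma heat_kernel_le_off_diagonal:
  fixes q :: real
  assumes "0 \<le> q"
  obtains C where "0 < C"
    "\<And>t r (x::'a::euclidean_space) y. 0 < t \<Longrightarrow> 0 < r \<Longrightarrow> r \<le> norm (x - y) \<Longrightarrow>
       heat_kernel t x y \<le> C * t powr q / r powr (real DIM('a) + 2 * q)"
proof -
  obtain C where C: "0 < C" "\<And>t (x::'a) y. 0 < t \<Longrightarrow>
       heat_kernel t x y * norm (x - y) powr (real DIM('a) + 2 * q) \<le> C * t powr q"
    using heat_kernel_decay[OF assms] by blast
  have "heat_kernel t x y \<le> C * t powr q / r powr (real DIM('a) + 2 * q)"
    if "0 < t" "0 < r" "r \<le> norm (x - y)" for t r and x y :: 'a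
  proof -
    have "heat_kernel t x y * r powr (real DIM('a) + 2 * q)
        \<le> heat_kernel t x y * norm (x - y) powr (real DIM('a) + 2 * q)"
      using that assms heat_kernel_pos[of t x y] by (intro mult_left_mono powr_mono2) auto
    also have "\<dots> \<le> C * t powr q" using C(2) that by simp
    finally show ?thesis using that by (simp add: pos_le_divide_eq)
  qed
  then show ?thesis using that C(1) by blast
qed

definition cutoff :: "'a::euclidean_space \<Rightarrow> real \<Rightarrow> 'a \<Rightarrow> real" where
  "cutoff y \<delta> z = max 0 (min 1 (2 - 2 * norm (y - z) / \<delta>))"

lemma cutoff_bounds: "0 \<le> cutoff y \<delta> z" "cutoff y \<delta> z \<le> 1"
  by (auto simp: cutoff_def)

lemma cutoff_eq_1: "0 < \<delta> \<Longrightarrow> norm (y - z) \<le> \<delta> / 2 \<Longrightarrow> cutoff y \<delta> z = 1"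
  by (simp add: cutoff_def field_simps)

lemma cutoff_eq_0: "0 < \<delta> \<Longrightarrow> \<delta> \<le> norm (y - z) \<Longrightarrow> cutoff y \<delta> z = 0"
  by (simp add: cutoff_def field_simps)

lemma continuous_on_cutoff [continuous_intros]: "continuous_on S (cutoff y \<delta>)"
  unfolding cutoff_def divide_inverse by (intro continuous_intros)

lemma measurable_cutoff [measurable]: "cutoff y \<delta> \<in> borel_measurable borel"
  by (intro borel_measurable_continuous_onI continuous_on_cutoff)

lemma integrable_heat_kernel_cutoff:
  "0 < \<tau> \<Longrightarrow> integrable lborel (\<lambda>z. heat_kernel \<tau> y z * cutoff y \<delta> z)"
  using cutoff_bounds[of y \<delta>] heat_kernel_pos[of \<tau> y]
  by (intro Bochner_Integration.integrable_bound[OF heat_kernel_integrable[of \<tau> y]])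
     (auto intro!: AE_I2 mult_left_le simp: abs_mult less_imp_le)

lemma tendsto_integral_heat_kernel_cutoff:
  fixes y :: "'a::euclidean_space"
  assumes \<delta>: "0 < \<delta>"
  shows "((\<lambda>\<tau>. \<integral>z. heat_kernel \<tau> y z * cutoff y \<delta> z \<partial>lborel) \<longlongrightarrow> 1) (at_right 0)"
proof -
  obtain C where C: "0 < C" "\<And>t (x::'a). 0 < t \<Longrightarrow>
       (\<integral>\<^sup>+y. ennreal (heat_kernel t x y * norm (x - y) powr (2 * 1)) \<partial>lborel) \<le> ennreal (C * t powr 1)"
    using heat_kernel_moment[of 1] by auto
  have bounds: "1 - C * 4 / \<delta>\<^sup>2 * \<tau> \<le> (\<integral>z. heat_kernel \<tau> y z * cutoff y \<delta> z \<partial>lborel)"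
    "(\<integral>z. heat_kernel \<tau> y z * cutoff y \<delta> z \<partial>lborel) \<le> 1" if \<tau>: "0 < \<tau>" for \<tau>
  proof -
    let ?I = "\<integral>z. heat_kernel \<tau> y z * cutoff y \<delta> z \<partial>lborel"
    have le: "heat_kernel \<tau> y z - heat_kernel \<tau> y z * cutoff y \<delta> z
        \<le> 4 / \<delta>\<^sup>2 * (heat_kernel \<tau> y z * norm (y - z) powr (2 * 1))" for z
    proof (cases "norm (y - z) \<le> \<delta> / 2")
      case True
      then show ?thesis using \<delta> \<tau> heat_kernel_pos[of \<tau> y z] by (simp add: cutoff_eq_1)
    next
      case False
      then have "(\<delta> / 2)\<^sup>2 \<le> (norm (y - z))\<^sup>2" using \<delta> by (intro power_mono) auto
      then have "1 \<le> 4 / \<delta>\<^sup>2 * (norm (y - z))\<^sup>2" using \<delta> by (simp add: power_divide field_simps)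
      then have "heat_kernel \<tau> y z * 1 \<le> heat_kernel \<tau> y z * (4 / \<delta>\<^sup>2 * (norm (y - z))\<^sup>2)"
        using \<tau> heat_kernel_pos[of \<tau> y z] by (intro mult_left_mono) auto
      moreover have "0 \<le> heat_kernel \<tau> y z * cutoff y \<delta> z"
        using \<tau> heat_kernel_pos[of \<tau> y z] cutoff_bounds[of y \<delta> z] by simp
      ultimately show ?thesis by (simp add: mult_ac)
    qed
    have int: "integrable lborel (\<lambda>z. heat_kernel \<tau> y z * norm (y - z) powr (2 * 1))"
      using C(2)[OF \<tau>, of y] \<tau> heat_kernel_pos[of \<tau> y]
      by (intro integrableI_bounded) (auto simp: abs_mult less_imp_le elim: le_less_trans)
    have mom: "(\<integral>z. heat_kernel \<tau> y z * norm (y - z) powr (2 * 1) \<partial>lborel) \<le> C * \<tau>"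
      using C \<tau> heat_kernel_pos[of \<tau> y] C(2)[OF \<tau>, of y]
      by (subst integral_eq_nn_integral) (auto simp: less_imp_le intro!: enn2real_leI)
    have "1 - ?I = (\<integral>z. heat_kernel \<tau> y z - heat_kernel \<tau> y z * cutoff y \<delta> z \<partial>lborel)"
      using \<tau> by (subst Bochner_Integration.integral_diff)
        (auto simp: heat_kernel_integral heat_kernel_integrable integrable_heat_kernel_cutoff)
    also have "\<dots> \<le> (\<integral>z. 4 / \<delta>\<^sup>2 * (heat_kernel \<tau> y z * norm (y - z) powr (2 * 1)) \<partial>lborel)"
      using \<tau> int le
      by (intro integral_mono Bochner_Integration.integrable_diff integrable_mult_right
          heat_kernel_integrable integrable_heat_kernel_cutoff) auto
    also have "\<dots> = 4 / \<delta>\<^sup>2 * (\<integral>z. heat_kernel \<tau> y z * norm (y - z) powr (2 * 1) \<partial>lborel)"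
      by (rule integral_mult_right_zero)
    also have "\<dots> \<le> 4 / \<delta>\<^sup>2 * (C * \<tau>)" using mom by (intro mult_left_mono) auto
    finally show "1 - C * 4 / \<delta>\<^sup>2 * \<tau> \<le> ?I" by (simp add: mult_ac)
    have "?I \<le> (\<integral>z. heat_kernel \<tau> y z \<partial>lborel)"
      using \<tau> cutoff_bounds[of y \<delta>] heat_kernel_pos[of \<tau> y]
      by (intro integral_mono heat_kernel_integrable integrable_heat_kernel_cutoff)
        (auto intro!: mult_left_le simp: less_imp_le)
    then show "?I \<le> 1" using \<tau> by (simp add: heat_kernel_integral)
  qed
  have "((\<lambda>\<tau>. 1 - C * 4 / \<delta>\<^sup>2 * \<tau>) \<longlongrightarrow> 1 - C * 4 / \<delta>\<^sup>2 * 0) (at_right 0)"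
    by (intro tendsto_intros)
  then have lim: "((\<lambda>\<tau>. 1 - C * 4 / \<delta>\<^sup>2 * \<tau>) \<longlongrightarrow> 1) (at_right 0)" by simp
  show ?thesis
    by (rule tendsto_sandwich[OF _ _ lim tendsto_const])
       (rule eventually_mono[OF eventually_at_right_less[of 0]], erule bounds)+
qed

text \<open>Testing the kernel with truncated heat kernels, which concentrate at \<open>y\<close> as \<open>\<tau> \<rightarrow> 0\<close>, turns
  bounds for solutions into pointwise bounds for \<open>K\<close>.\<close>

lemma dirichlet_kernel_bounds_from_solutions:
  fixes \<Omega> :: "'a::euclidean_space set"
  assumes K: "dirichlet_heat_kernel \<Omega> K"
    and \<Omega>: "open \<Omega>" and x: "x \<in> \<Omega>" and y: "y \<in> \<Omega>" and t: "0 < t"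
    and lo: "\<And>\<delta>. 0 < \<delta> \<Longrightarrow> (lo \<delta> \<longlongrightarrow> A) (at_right 0)"
    and hi: "(hi \<longlongrightarrow> B) (at_right 0)"
    and bounds: "\<And>\<delta> \<tau> v. 0 < \<delta> \<Longrightarrow> 0 < \<tau> \<Longrightarrow>
      dirichlet_heat_solution \<Omega> (\<lambda>z. heat_kernel \<tau> y z * cutoff y \<delta> z) v \<Longrightarrow> lo \<delta> \<tau> \<le> v t x \<and> v t x \<le> hi \<tau>"
  shows "A \<le> K t x y" "K t x y \<le> B"
proof -
  have contK: "continuous_on \<Omega> (K t x)"
  proof -
    have "continuous_on \<Omega> ((\<lambda>(t, x, y). K t x y) \<circ> (\<lambda>y. (t, x, y)))"
      using K t x unfolding dirichlet_heat_kernel_def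
      by (intro continuous_on_compose continuous_intros)
         (auto elim: continuous_on_subset)
    then show ?thesis by (simp add: o_def)
  qed
  have main: "A \<le> K t x y + \<eta> \<and> K t x y - \<eta> \<le> B" if \<eta>: "0 < \<eta>" for \<eta>
  proof -
    obtain d1 where d1: "0 < d1" "cball y d1 \<subseteq> \<Omega>"
      using \<Omega> y open_contains_cball by blast
    obtain d2 where d2: "0 < d2" "\<And>z. z \<in> \<Omega> \<Longrightarrow> dist z y < d2 \<Longrightarrow> \<bar>K t x z - K t x y\<bar> < \<eta>"
      using contK y \<eta> unfolding continuous_on_iff dist_real_def by metis
    define \<delta> where "\<delta> = min d1 d2 / 2"
    have \<delta>: "0 < \<delta>" "cball y \<delta> \<subseteq> \<Omega>" and close: "\<And>z. z \<in> cball y \<delta> \<Longrightarrow> \<bar>K t x z - K t x y\<bar> < \<eta>"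
      using d1 d2 by (auto simp: \<delta>_def dist_commute subset_iff)
    define f where "f = (\<lambda>\<tau> z. heat_kernel \<tau> y z * cutoff y \<delta> z)"
    have f_supp: "f \<tau> z = 0" if "z \<notin> cball y \<delta>" for \<tau> z
      using that \<delta> by (simp add: f_def cutoff_eq_0 dist_norm)
    have step: "lo \<delta> \<tau> \<le> (K t x y + \<eta>) * integral\<^sup>L lborel (f \<tau>) \<and>
        (K t x y - \<eta>) * integral\<^sup>L lborel (f \<tau>) \<le> hi \<tau>" if \<tau>: "0 < \<tau>" for \<tau>
    proof -
      have f_nonneg: "0 \<le> f \<tau> z" for z
        using \<tau> heat_kernel_pos[of \<tau> y z] cutoff_bounds[of y \<delta> z] by (simp add: f_def)
      have "continuous_on UNIV (f \<tau>)"
        unfolding f_def using \<tau>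
        by (subst heat_kernel_commute) (intro continuous_intros continuous_on_heat_kernel, auto)
      then obtain v where v: "dirichlet_heat_solution \<Omega> (f \<tau>) v"
          "v t x = heat_semigroup \<Omega> K t (f \<tau>) x"
        using K t x f_supp \<delta>(2) compact_cball[of y \<delta>] unfolding dirichlet_heat_kernel_def by metis
      have f_int: "integrable lborel (f \<tau>)"
        unfolding f_def using \<tau> by (rule integrable_heat_kernel_cutoff)
      have Kf: "(K t x y - \<eta>) * f \<tau> z \<le> indicator \<Omega> z *\<^sub>R (K t x z * f \<tau> z)"
          "indicator \<Omega> z *\<^sub>R (K t x z * f \<tau> z) \<le> (K t x y + \<eta>) * f \<tau> z" for z
      proof -
        have "(K t x y - \<eta>) * f \<tau> z \<le> indicator \<Omega> z *\<^sub>R (K t x z * f \<tau> z) \<and>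
          indicator \<Omega> z *\<^sub>R (K t x z * f \<tau> z) \<le> (K t x y + \<eta>) * f \<tau> z"
        proof (cases "z \<in> cball y \<delta>")
          case True
          then have "z \<in> \<Omega>" "K t x y - \<eta> \<le> K t x z" "K t x z \<le> K t x y + \<eta>"
            using close[OF True] \<delta>(2) by (auto simp: abs_less_iff)
          then show ?thesis using f_nonneg[of z] by (simp add: mult_right_mono)
        next
          case False
          then show ?thesis using f_supp[OF False, of \<tau>] by simp
        qed
        then show "(K t x y - \<eta>) * f \<tau> z \<le> indicator \<Omega> z *\<^sub>R (K t x z * f \<tau> z)"
          "indicator \<Omega> z *\<^sub>R (K t x z * f \<tau> z) \<le> (K t x y + \<eta>) * f \<tau> z" by blast+
      qed
      have "(\<lambda>z. indicator \<Omega> z *\<^sub>R K t x z) \<in> borel_measurable borel"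
        using \<Omega> contK by (intro borel_measurable_continuous_on_indicator) auto
      then have meas: "(\<lambda>z. indicator \<Omega> z *\<^sub>R K t x z * f \<tau> z) \<in> borel_measurable borel"
        using f_int by (intro borel_measurable_times) auto
      have norm: "\<bar>indicator \<Omega> z *\<^sub>R (K t x z * f \<tau> z)\<bar> \<le> \<bar>(\<bar>K t x y\<bar> + \<eta>) * f \<tau> z\<bar>" for z
      proof -
        have "- (\<bar>K t x y\<bar> + \<eta>) * f \<tau> z \<le> (K t x y - \<eta>) * f \<tau> z"
          "(K t x y + \<eta>) * f \<tau> z \<le> (\<bar>K t x y\<bar> + \<eta>) * f \<tau> z"
          using f_nonneg[of z] by (auto intro!: mult_right_mono)
        then show ?thesis using Kf[of z] by (simp only: minus_mult_left[symmetric])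
      qed
      from meas have Kf_int: "integrable lborel (\<lambda>z. indicator \<Omega> z *\<^sub>R (K t x z * f \<tau> z))"
        by (intro Bochner_Integration.integrable_bound[OF integrable_mult_right[OF f_int, of "\<bar>K t x y\<bar> + \<eta>"]])
           (use norm in \<open>auto intro!: AE_I2 simp: mult.assoc\<close>)
      have veq: "v t x = (\<integral>z. indicator \<Omega> z *\<^sub>R (K t x z * f \<tau> z) \<partial>lborel)"
        unfolding v(2) heat_semigroup_def set_lebesgue_integral_def ..
      have "(K t x y - \<eta>) * integral\<^sup>L lborel (f \<tau>) \<le> v t x"
        unfolding veq integral_mult_right_zero[symmetric]
        by (intro integral_mono integrable_mult_right f_int Kf_int Kf)
      moreover have "v t x \<le> (K t x y + \<eta>) * integral\<^sup>L lborel (f \<tau>)"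
        unfolding veq integral_mult_right_zero[symmetric]
        by (intro integral_mono integrable_mult_right f_int Kf_int Kf)
      ultimately show ?thesis
        using bounds[OF \<delta>(1) \<tau> v(1)[unfolded f_def]] by linarith
    qed
    have lim: "((\<lambda>\<tau>. c * integral\<^sup>L lborel (f \<tau>)) \<longlongrightarrow> c) (at_right 0)" for c
      using tendsto_mult[OF tendsto_const[of c] tendsto_integral_heat_kernel_cutoff[OF \<delta>(1), of y]]
      by (simp add: f_def)
    have "A \<le> K t x y + \<eta>"
      by (rule tendsto_le[OF _ lim lo[OF \<delta>(1)]]) (use step in \<open>auto intro!: eventually_at_rightI[of 0 1]\<close>)
    moreover have "K t x y - \<eta> \<le> B"
      by (rule tendsto_le[OF _ hi lim]) (use step in \<open>auto intro!: eventually_at_rightI[of 0 1]\<close>)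
    ultimately show ?thesis by blast
  qed
  show "A \<le> K t x y"
  proof (rule field_le_epsilon)
    fix e :: real assume "0 < e"
    then show "A \<le> K t x y + e" using main by blast
  qed
  show "K t x y \<le> B"
  proof (rule field_le_epsilon)
    fix e :: real assume "0 < e"
    then show "K t x y \<le> B + e" using main[of e] by linarith
  qed
qed

context
  fixes \<Omega> :: "'a::euclidean_space set" and f :: "'a \<Rightarrow> real" and v :: "real \<Rightarrow> 'a \<Rightarrow> real"
  assumes \<Omega>: "open \<Omega>" and v: "dirichlet_heat_solution \<Omega> f v"
begin

lemma dirichlet_heat_solution_bounded:
  obtains B where "0 < B" "\<And>t x. 0 \<le> t \<Longrightarrow> x \<in> closure \<Omega> \<Longrightarrow> \<bar>v t x\<bar> \<le> B"
proof -
  have "bounded ((\<lambda>(t, x). v t x) ` ({0..} \<times> closure \<Omega>))"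
    using v by (simp add: dirichlet_heat_solution_def)
  then obtain B where B: "0 < B" "\<forall>z\<in>(\<lambda>(t, x). v t x) ` ({0..} \<times> closure \<Omega>). norm z \<le> B"
    by (auto simp: bounded_pos)
  have "\<bar>v t x\<bar> \<le> B" if "0 \<le> t" "x \<in> closure \<Omega>" for t x
    using B(2)[rule_format, of "v t x"] that by force
  then show ?thesis using that B(1) by blast
qed

lemma dirichlet_heat_solution_nonneg:
  assumes f: "\<And>x. x \<in> \<Omega> \<Longrightarrow> 0 \<le> f x" and t: "0 \<le> t" and x: "x \<in> \<Omega>"
  shows "0 \<le> v t x"
proof -
  obtain B where B: "0 < B" "\<And>t x. 0 \<le> t \<Longrightarrow> x \<in> closure \<Omega> \<Longrightarrow> \<bar>v t x\<bar> \<le> B"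
    using dirichlet_heat_solution_bounded by blast
  show ?thesis
  proof (rule parabolic_minimum_principle[OF \<Omega> _ _ dirichlet_heat_solution_caloric[OF v], where T = t and B = "- B"])
    show "continuous_on ({0..} \<times> closure \<Omega>) (\<lambda>(t, x). v t x)"
      using v by (simp add: dirichlet_heat_solution_def)
    show "- B \<le> v t x" if "0 \<le> t" "x \<in> closure \<Omega>" for t x using B(2)[OF that] by simp
    show "0 \<le> v 0 x" if "x \<in> \<Omega>" for x using v f that by (simp add: dirichlet_heat_solution_def)
    show "0 \<le> v t x" if "0 \<le> t" "x \<in> frontier \<Omega>" for t x
      using v that by (simp add: dirichlet_heat_solution_def)
  qed (use t x closure_subset in auto)
qed

lemma continuous_on_heat_kernel_minus_solution:
  assumes "0 < \<tau>"
  shows "continuous_on ({0..} \<times> closure \<Omega>) (\<lambda>(t, x). heat_kernel (t + \<tau>) x y - v t x)"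
  using v assms unfolding dirichlet_heat_solution_def case_prod_beta
  by (intro continuous_on_diff continuous_on_heat_kernel continuous_intros) auto

lemma dirichlet_heat_solution_le_heat_kernel:
  assumes \<tau>: "0 < \<tau>" and f: "\<And>x. x \<in> \<Omega> \<Longrightarrow> f x \<le> heat_kernel \<tau> x y"
    and t: "0 \<le> t" and x: "x \<in> \<Omega>"
  shows "v t x \<le> heat_kernel (t + \<tau>) x y"
proof -
  obtain B where B: "0 < B" "\<And>t x. 0 \<le> t \<Longrightarrow> x \<in> closure \<Omega> \<Longrightarrow> \<bar>v t x\<bar> \<le> B"
    using dirichlet_heat_solution_bounded by blast
  have "0 \<le> heat_kernel (t + \<tau>) x y - v t x"
  proof (rule parabolic_minimum_principle[OF \<Omega> continuous_on_heat_kernel_minus_solution[OF \<tau>],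
        where T = t and B = "- B"])
    show "- B \<le> heat_kernel (t + \<tau>) x y - v t x" if "0 \<le> t" "x \<in> closure \<Omega>" for t x
      using B(2)[OF that] heat_kernel_pos[of "t + \<tau>" x y] that \<tau> by simp
    show "caloric \<Omega> (\<lambda>t x. heat_kernel (t + \<tau>) x y - v t x)"
      using \<tau> by (intro caloric_diff heat_kernel_caloric dirichlet_heat_solution_caloric[OF v]) auto
    show "0 \<le> heat_kernel (0 + \<tau>) x y - v 0 x" if "x \<in> \<Omega>" for x
      using v f that by (simp add: dirichlet_heat_solution_def)
    show "0 \<le> heat_kernel (t + \<tau>) x y - v t x" if "0 \<le> t" "x \<in> frontier \<Omega>" for t x
      using v that \<tau> heat_kernel_pos[of "t + \<tau>" x y] by (simp add: dirichlet_heat_solution_def)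
  qed (use t x closure_subset in auto)
  then show ?thesis by simp
qed

lemma dirichlet_heat_solution_ge_heat_kernel:
  assumes \<tau>: "0 < \<tau>"
    and init: "\<And>x. x \<in> \<Omega> \<Longrightarrow> heat_kernel \<tau> x y - f x \<le> M"
    and bdry: "\<And>s z. 0 \<le> s \<Longrightarrow> s \<le> t \<Longrightarrow> z \<in> frontier \<Omega> \<Longrightarrow> heat_kernel (s + \<tau>) z y \<le> M"
    and t: "0 \<le> t" and x: "x \<in> \<Omega>"
  shows "heat_kernel (t + \<tau>) x y - M \<le> v t x"
proof -
  obtain B where B: "0 < B" "\<And>t x. 0 \<le> t \<Longrightarrow> x \<in> closure \<Omega> \<Longrightarrow> \<bar>v t x\<bar> \<le> B"
    using dirichlet_heat_solution_bounded by blast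
  define H where "H = (4 * pi * \<tau>) powr (- real DIM('a) / 2)"
  have H: "heat_kernel (s + \<tau>) z y \<le> H" if "0 \<le> s" for s z
  proof -
    have "(4 * pi * (s + \<tau>)) powr (- real DIM('a) / 2) \<le> H"
      unfolding H_def using that \<tau> by (intro powr_mono2') auto
    moreover have "exp (- (norm (z - y))\<^sup>2 / (4 * (s + \<tau>))) \<le> 1"
      using that \<tau> by simp
    ultimately have "heat_kernel (s + \<tau>) z y \<le> H * 1"
      unfolding heat_kernel_def by (intro mult_mono) (auto simp: H_def)
    then show ?thesis by simp
  qed
  have "- M \<le> v t x - heat_kernel (t + \<tau>) x y"
  proof (rule parabolic_minimum_principle[OF \<Omega>, where T = t and B = "- B - H"
        and w = "\<lambda>t x. v t x - heat_kernel (t + \<tau>) x y"])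
    show "continuous_on ({0..} \<times> closure \<Omega>) (\<lambda>(t, x). v t x - heat_kernel (t + \<tau>) x y)"
      using continuous_on_minus[OF continuous_on_heat_kernel_minus_solution[OF \<tau>]]
      by (simp add: case_prod_beta)
    show "- B - H \<le> v t x - heat_kernel (t + \<tau>) x y" if "0 \<le> t" "x \<in> closure \<Omega>" for t x
      using B(2)[OF that] H[of t x] that by simp
    show "caloric \<Omega> (\<lambda>t x. v t x - heat_kernel (t + \<tau>) x y)"
      using \<tau> by (intro caloric_diff heat_kernel_caloric dirichlet_heat_solution_caloric[OF v]) auto
    show "- M \<le> v 0 x - heat_kernel (0 + \<tau>) x y" if "x \<in> \<Omega>" for x
      using v init[OF that] that by (simp add: dirichlet_heat_solution_def)
    show "- M \<le> v s z - heat_kernel (s + \<tau>) z y" if "0 \<le> s" "s \<le> t" "z \<in> frontier \<Omega>" for s z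
      using v that bdry[OF that] by (simp add: dirichlet_heat_solution_def)
  qed (use t x closure_subset in auto)
  then show ?thesis by simp
qed

end

context
  fixes \<Omega> :: "'a::euclidean_space set" and K :: "real \<Rightarrow> 'a \<Rightarrow> 'a \<Rightarrow> real"
  assumes \<Omega>: "open \<Omega>" and K: "dirichlet_heat_kernel \<Omega> K"
begin

lemma dirichlet_kernel_bounds:
  assumes t: "0 < t" and x: "x \<in> \<Omega>" and y: "y \<in> \<Omega>"
  shows "0 \<le> K t x y" "K t x y \<le> heat_kernel t x y"
proof -
  have *: "0 \<le> v t x \<and> v t x \<le> heat_kernel (t + \<tau>) x y"
    if "0 < \<tau>" "dirichlet_heat_solution \<Omega> (\<lambda>z. heat_kernel \<tau> y z * cutoff y \<delta> z) v" for \<delta> \<tau> v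
    using that t x cutoff_bounds[of y \<delta>] heat_kernel_pos[of \<tau> y]
    by (intro conjI dirichlet_heat_solution_nonneg[OF \<Omega> that(2)]
          dirichlet_heat_solution_le_heat_kernel[OF \<Omega> that(2)])
       (auto simp: heat_kernel_commute[of \<tau> _ y] less_imp_le intro!: mult_left_le)
  note b = dirichlet_kernel_bounds_from_solutions[OF K \<Omega> x y t, of "\<lambda>_ _. 0" 0]
  show "0 \<le> K t x y" "K t x y \<le> heat_kernel t x y"
    by (rule b, rule tendsto_const, rule tendsto_heat_kernel_time[OF t], use * in blast)+
qed

lemma dirichlet_kernel_ge:
  fixes q :: real
  assumes q: "0 < q"
  obtains C where "0 < C" "\<And>t r x y. 0 < t \<Longrightarrow> 0 < r \<Longrightarrow> x \<in> \<Omega> \<Longrightarrow> y \<in> \<Omega> \<Longrightarrow>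
    (\<And>z. z \<in> frontier \<Omega> \<Longrightarrow> r \<le> norm (z - y)) \<Longrightarrow>
    heat_kernel t x y - C * t powr q / r powr (real DIM('a) + 2 * q) \<le> K t x y"
proof -
  obtain C where C: "0 < C" "\<And>t r (x::'a) y. 0 < t \<Longrightarrow> 0 < r \<Longrightarrow> r \<le> norm (x - y) \<Longrightarrow>
       heat_kernel t x y \<le> C * t powr q / r powr (real DIM('a) + 2 * q)"
    using heat_kernel_le_off_diagonal[of q] q by auto
  have "heat_kernel t x y - C * t powr q / r powr (real DIM('a) + 2 * q) \<le> K t x y"
    if t: "0 < t" and r: "0 < r" and x: "x \<in> \<Omega>" and y: "y \<in> \<Omega>"
      and far: "\<And>z. z \<in> frontier \<Omega> \<Longrightarrow> r \<le> norm (z - y)" for t r x y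
  proof -
    define e where "e = real DIM('a) + 2 * q"
    define M where "M = (\<lambda>\<delta> \<tau>. C * \<tau> powr q / (\<delta> / 2) powr e + C * (t + \<tau>) powr q / r powr e)"
    show ?thesis
    proof (rule dirichlet_kernel_bounds_from_solutions(1)[OF K \<Omega> x y t _ tendsto_heat_kernel_time[OF t]])
      fix \<delta> :: real assume \<delta>: "0 < \<delta>"
      have 1: "((\<lambda>\<tau>. (t + \<tau>) powr q) \<longlongrightarrow> (t + 0) powr q) (at_right 0)"
        using t by (intro tendsto_intros) auto
      have 2: "((\<lambda>\<tau>. \<tau> powr q) \<longlongrightarrow> 0) (at_right (0::real))"
        using q by (intro tendsto_zero_powrI tendsto_intros) (auto intro!: eventually_at_rightI[of 0 1])
      have "(M \<delta> \<longlongrightarrow> C * 0 / (\<delta> / 2) powr e + C * (t + 0) powr q / r powr e) (at_right 0)"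
        unfolding M_def using \<delta> r
        by (intro tendsto_add tendsto_divide tendsto_mult tendsto_const 1 2) auto
      then have "(M \<delta> \<longlongrightarrow> C * t powr q / r powr e) (at_right 0)" by simp
      then show "((\<lambda>\<tau>. heat_kernel (t + \<tau>) x y - M \<delta> \<tau>) \<longlongrightarrow>
          heat_kernel t x y - C * t powr q / r powr (real DIM('a) + 2 * q)) (at_right 0)"
        unfolding e_def[symmetric] by (intro tendsto_diff tendsto_heat_kernel_time[OF t])
    next
      fix \<delta> \<tau> :: real and v
      assume \<delta>: "0 < \<delta>" and \<tau>: "0 < \<tau>"
        and v: "dirichlet_heat_solution \<Omega> (\<lambda>z. heat_kernel \<tau> y z * cutoff y \<delta> z) v"
      have M1: "C * \<tau> powr q / (\<delta> / 2) powr e \<le> M \<delta> \<tau>" and M0: "0 \<le> M \<delta> \<tau>"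
        and M2: "C * (t + \<tau>) powr q / r powr e \<le> M \<delta> \<tau>"
        using C(1) by (auto simp: M_def)
      have "heat_kernel (t + \<tau>) x y - M \<delta> \<tau> \<le> v t x"
      proof (rule dirichlet_heat_solution_ge_heat_kernel[OF \<Omega> v \<tau>])
        fix z assume "z \<in> \<Omega>"
        show "heat_kernel \<tau> z y - heat_kernel \<tau> y z * cutoff y \<delta> z \<le> M \<delta> \<tau>"
        proof (cases "norm (y - z) \<le> \<delta> / 2")
          case True
          then show ?thesis using \<delta> M0 by (simp add: cutoff_eq_1 heat_kernel_commute)
        next
          case False
          then have "heat_kernel \<tau> z y \<le> C * \<tau> powr q / (\<delta> / 2) powr e"
            using C(2)[OF \<tau>, of "\<delta> / 2" z y] \<delta> by (simp add: norm_minus_commute e_def)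
          moreover have "0 \<le> heat_kernel \<tau> y z * cutoff y \<delta> z"
            using \<tau> heat_kernel_pos[of \<tau> y z] cutoff_bounds[of y \<delta> z] by simp
          ultimately show ?thesis using M1 by linarith
        qed
      next
        fix s z assume s: "0 \<le> s" "s \<le> t" and z: "z \<in> frontier \<Omega>"
        have "heat_kernel (s + \<tau>) z y \<le> C * (s + \<tau>) powr q / r powr e"
          unfolding e_def using s \<tau> r far[OF z] by (intro C(2)) auto
        also have "\<dots> \<le> C * (t + \<tau>) powr q / r powr e"
          using s \<tau> C(1) q by (intro divide_right_mono mult_left_mono powr_mono2) auto
        finally show "heat_kernel (s + \<tau>) z y \<le> M \<delta> \<tau>" using M2 by simp
      qed (use t x in auto)
      moreover have "v t x \<le> heat_kernel (t + \<tau>) x y"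
        using \<tau> t x cutoff_bounds[of y \<delta>] heat_kernel_pos[of \<tau> y]
        by (intro dirichlet_heat_solution_le_heat_kernel[OF \<Omega> v])
          (auto simp: heat_kernel_commute[of \<tau> _ y] less_imp_le intro!: mult_left_le)
      ultimately show "heat_kernel (t + \<tau>) x y - M \<delta> \<tau> \<le> v t x \<and> v t x \<le> heat_kernel (t + \<tau>) x y"
        by blast
    qed
  qed
  then show ?thesis using that C(1) by blast
qed

end

section \<open>Iterated integrals over space and time\<close>

definition weighted :: "real \<Rightarrow> 'a set \<Rightarrow> (real \<Rightarrow> 'a \<Rightarrow> real) \<Rightarrow> real \<times> 'a \<Rightarrow> real" where
  "weighted \<sigma> A F = (\<lambda>(t, y). indicator {0<..} t * indicator A y * F t y / t powr (1 + \<sigma> / 2))"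

lemma weighted_section:
  fixes A :: "'a::euclidean_space set"
  shows "(\<integral>y. weighted \<sigma> A F (t, y) \<partial>lborel) = indicator {0<..} t *\<^sub>R ((LINT y:A|lborel. F t y) / t powr (1 + \<sigma> / 2))"
proof -
  have "weighted \<sigma> A F (t, y) = (indicator {0<..} t / t powr (1 + \<sigma> / 2)) * (indicator A y *\<^sub>R F t y)" for y
    by (simp add: weighted_def)
  then show ?thesis
    by (simp only: integral_mult_right_zero set_lebesgue_integral_def) simp
qed

lemma weighted_section_integrable:
  assumes "0 < t \<Longrightarrow> set_integrable lborel A (F t)"
  shows "integrable lborel (\<lambda>y. weighted \<sigma> A F (t, y))"
proof (cases "0 < t")
  case True
  have "weighted \<sigma> A F (t, y) = (1 / t powr (1 + \<sigma> / 2)) * (indicator A y *\<^sub>R F t y)" for y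
    using True by (simp add: weighted_def)
  then show ?thesis
    using assms[OF True] unfolding set_integrable_def by simp
qed (simp add: weighted_def)

lemma iterated_integral_eq_weighted:
  fixes A :: "'a::euclidean_space set"
  assumes "integrable (lborel \<Otimes>\<^sub>M lborel) (weighted \<sigma> A F)"
  shows "(LINT t:{0<..}|lborel. (LINT y:A|lborel. F t y) / t powr (1 + \<sigma> / 2))
     = integral\<^sup>L (lborel \<Otimes>\<^sub>M lborel) (weighted \<sigma> A F)"
  using lborel_pair.integral_fst'[OF assms]
  by (simp add: weighted_section set_lebesgue_integral_def)

lemma weighted_integrable_iff:
  fixes A :: "'a::euclidean_space set"
  assumes meas: "weighted \<sigma> A F \<in> borel_measurable (lborel \<Otimes>\<^sub>M lborel)"
    and nonneg: "\<And>t y. 0 < t \<Longrightarrow> y \<in> A \<Longrightarrow> 0 \<le> F t y"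
    and inner: "\<And>t. 0 < t \<Longrightarrow> set_integrable lborel A (F t)"
  shows "integrable (lborel \<Otimes>\<^sub>M lborel) (weighted \<sigma> A F) \<longleftrightarrow>
    set_integrable lborel {0<..} (\<lambda>t. (LINT y:A|lborel. F t y) / t powr (1 + \<sigma> / 2))"
proof
  assume "integrable (lborel \<Otimes>\<^sub>M lborel) (weighted \<sigma> A F)"
  from lborel_pair.integrable_fst'[OF this]
  show "set_integrable lborel {0<..} (\<lambda>t. (LINT y:A|lborel. F t y) / t powr (1 + \<sigma> / 2))"
    by (simp add: weighted_section set_integrable_def)
next
  assume *: "set_integrable lborel {0<..} (\<lambda>t. (LINT y:A|lborel. F t y) / t powr (1 + \<sigma> / 2))"
  have "0 \<le> weighted \<sigma> A F z" for z
    using nonneg by (auto simp: weighted_def indicator_def split: prod.split)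
  then have "norm (weighted \<sigma> A F z) = weighted \<sigma> A F z" for z by simp
  then show "integrable (lborel \<Otimes>\<^sub>M lborel) (weighted \<sigma> A F)"
    using * weighted_section_integrable[of _ A F \<sigma>, OF inner]
    by (intro lborel_pair.Fubini_integrable meas) (auto simp: weighted_section set_integrable_def)
qed

lemma set_integrable_over_powr:
  fixes f :: "real \<Rightarrow> real"
  assumes e: "1 < e" and q: "e - 1 < q"
    and meas: "(\<lambda>t. indicator {0<..} t *\<^sub>R (f t / t powr e)) \<in> borel_measurable borel"
    and f: "\<And>t. 0 < t \<Longrightarrow> 0 \<le> f t" "\<And>t. 0 < t \<Longrightarrow> f t \<le> M" "\<And>t. 0 < t \<Longrightarrow> f t \<le> C * t powr q"
  shows "set_integrable lborel {0<..} (\<lambda>t. f t / t powr e)"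
proof -
  have 1: "set_integrable lborel {0..1} (\<lambda>t::real. t powr (q - e))"
  proof -
    have "(\<lambda>t::real. t powr (q - e)) absolutely_integrable_on {0..1}"
      using has_integral_powr_from_0[of "q - e" 1] q
      by (intro nonnegative_absolutely_integrable_1) (auto simp: has_integral_iff)
    then show ?thesis
      unfolding set_integrable_def by (subst (asm) integrable_completion) auto
  qed
  have 2: "set_integrable lborel {1..} (\<lambda>t::real. t powr (- e))"
  proof -
    have "(\<lambda>t::real. t powr (- e)) absolutely_integrable_on {1..}"
      using has_integral_powr_to_inf[of "- e" 1] e
      by (intro nonnegative_absolutely_integrable_1) (auto simp: has_integral_iff)
    then show ?thesis
      unfolding set_integrable_def by (subst (asm) integrable_completion) auto
  qed
  define w where "w = (\<lambda>t. C * (indicator {0..1} t *\<^sub>R t powr (q - e)) + M * (indicator {1..} t *\<^sub>R t powr (- e)))"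
  have w: "integrable lborel w"
    using 1 2 unfolding w_def set_integrable_def
    by (intro Bochner_Integration.integrable_add integrable_mult_right)
  have M: "0 \<le> M" and C: "0 \<le> C" using f[of 1] by auto
  have bound: "norm (indicator {0<..} t *\<^sub>R (f t / t powr e)) \<le> norm (w t)" for t
  proof (cases "0 < t")
    case True
    have w1: "C * t powr (q - e) \<le> w t" if "t \<le> 1"
      using that True M by (simp add: w_def indicator_def)
    have w2: "M * t powr (- e) \<le> w t" if "1 \<le> t"
      using that C by (simp add: w_def indicator_def)
    have "f t / t powr e \<le> w t"
    proof (cases "t \<le> 1")
      case True
      have "f t / t powr e \<le> C * t powr q / t powr e"
        using f(3)[OF \<open>0 < t\<close>] by (intro divide_right_mono) auto
      then show ?thesis using w1[OF True] by (simp add: powr_diff)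
    next
      case False
      have "f t / t powr e \<le> M / t powr e"
        using f(2)[OF \<open>0 < t\<close>] by (intro divide_right_mono) auto
      then show ?thesis using w2 False by (simp add: powr_minus_divide)
    qed
    moreover have "0 \<le> f t / t powr e" using f(1)[OF True] by simp
    ultimately show ?thesis using True by simp
  qed simp
  show ?thesis
    unfolding set_integrable_def
    by (rule Bochner_Integration.integrable_bound[OF w]) (use meas bound in auto)
qed

lemma weighted_integrableI:
  fixes A :: "'a::euclidean_space set"
  assumes \<sigma>: "0 < \<sigma>" and q: "\<sigma> / 2 < q"
    and meas: "weighted \<sigma> A F \<in> borel_measurable (lborel \<Otimes>\<^sub>M lborel)"
    and nonneg: "\<And>t y. 0 < t \<Longrightarrow> y \<in> A \<Longrightarrow> 0 \<le> F t y"
    and inner: "\<And>t. 0 < t \<Longrightarrow> set_integrable lborel A (F t)"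
    and M: "\<And>t. 0 < t \<Longrightarrow> (LINT y:A|lborel. F t y) \<le> M"
    and C: "\<And>t. 0 < t \<Longrightarrow> (LINT y:A|lborel. F t y) \<le> C * t powr q"
  shows "integrable (lborel \<Otimes>\<^sub>M lborel) (weighted \<sigma> A F)"
proof (rule weighted_integrable_iff[THEN iffD2, OF meas nonneg inner])
  show "set_integrable lborel {0<..} (\<lambda>t. (LINT y:A|lborel. F t y) / t powr (1 + \<sigma> / 2))"
  proof (rule set_integrable_over_powr[where q = q and M = M and C = C])
  have "(\<lambda>t. \<integral>y. weighted \<sigma> A F (t, y) \<partial>lborel) \<in> borel_measurable lborel"
    using meas by (rule lborel.borel_measurable_lebesgue_integral[where f = "\<lambda>t y. weighted \<sigma> A F (t, y)", simplified])
  then show "(\<lambda>t. indicator {0<..} t *\<^sub>R ((LINT y:A|lborel. F t y) / t powr (1 + \<sigma> / 2))) \<in> borel_measurable borel"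
    by (simp add: weighted_section)
  show "0 \<le> (LINT y:A|lborel. F t y)" if "0 < t" for t
    unfolding set_lebesgue_integral_def using nonneg[OF that]
    by (intro integral_nonneg_AE) (auto simp: indicator_def)
qed (use \<sigma> q M C in auto)
qed

definition outside :: "real \<Rightarrow> (real \<times> 'a::euclidean_space \<Rightarrow> real) \<Rightarrow> real \<times> 'a \<Rightarrow> real" where
  "outside \<epsilon> f z = indicator {y. norm (0 - y) > \<epsilon>} (snd z) * f z"

lemma outside_measurable [measurable]:
  fixes f :: "real \<times> 'a::euclidean_space \<Rightarrow> real"
  assumes [measurable]: "f \<in> borel_measurable (lborel \<Otimes>\<^sub>M lborel)"
  shows "outside \<epsilon> f \<in> borel_measurable (lborel \<Otimes>\<^sub>M lborel)"
  unfolding outside_def[abs_def] by measurable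

lemma abs_outside_le: "\<bar>outside \<epsilon> f z\<bar> \<le> \<bar>f z\<bar>"
  by (simp add: outside_def indicator_def)

lemma tendsto_outside:
  assumes f0: "\<And>t. f (t, 0) = 0" and S: "S \<longlonglongrightarrow> 0"
  shows "(\<lambda>n. outside (S n) f z) \<longlonglongrightarrow> f z"
proof (cases "snd z = 0")
  case True
  then have "f z = 0" using f0[of "fst z"] by (metis prod.collapse)
  then show ?thesis by (simp add: outside_def)
next
  case False
  then have "\<forall>\<^sub>F n in sequentially. S n < norm (0 - snd z)"
    using order_tendstoD(2)[OF S] by simp
  then have "\<forall>\<^sub>F n in sequentially. outside (S n) f z = f z"
    by eventually_elim (simp add: outside_def)
  then show ?thesis by (rule tendsto_eventually)
qed

lemma tendsto_integral_outside:
  fixes f :: "real \<times> 'a::euclidean_space \<Rightarrow> real"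
  assumes f: "integrable (lborel \<Otimes>\<^sub>M lborel) f" and f0: "\<And>t. f (t, 0) = 0"
  shows "((\<lambda>\<epsilon>. integral\<^sup>L (lborel \<Otimes>\<^sub>M lborel) (outside \<epsilon> f)) \<longlongrightarrow> integral\<^sup>L (lborel \<Otimes>\<^sub>M lborel) f) (at_right 0)"
proof (rule tendsto_at_right_sequentially[of 0 1])
  fix S :: "nat \<Rightarrow> real" assume S: "S \<longlonglongrightarrow> 0"
  show "(\<lambda>n. integral\<^sup>L (lborel \<Otimes>\<^sub>M lborel) (outside (S n) f)) \<longlonglongrightarrow> integral\<^sup>L (lborel \<Otimes>\<^sub>M lborel) f"
    using f tendsto_outside[of f, OF f0 S] abs_outside_le[of _ f]
    by (intro integral_dominated_convergence[where w = "\<lambda>z. norm (f z)"]) auto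
qed simp

lemma integrable_of_tendsto_outside:
  fixes f :: "real \<times> 'a::euclidean_space \<Rightarrow> real"
  assumes meas: "f \<in> borel_measurable (lborel \<Otimes>\<^sub>M lborel)"
    and nonneg: "\<And>z. 0 \<le> f z" and f0: "\<And>t. f (t, 0) = 0"
    and int: "\<And>\<epsilon>. 0 < \<epsilon> \<Longrightarrow> integrable (lborel \<Otimes>\<^sub>M lborel) (outside \<epsilon> f)"
    and lim: "((\<lambda>\<epsilon>. integral\<^sup>L (lborel \<Otimes>\<^sub>M lborel) (outside \<epsilon> f)) \<longlongrightarrow> L) (at_right 0)"
  shows "integrable (lborel \<Otimes>\<^sub>M lborel) f"
proof -
  define S where "S = (\<lambda>n. inverse (real (Suc n)))"
  have S: "S \<longlonglongrightarrow> 0" unfolding S_def by (rule LIMSEQ_inverse_real_of_nat)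
  have pos: "0 < S n" for n by (simp add: S_def)
  have "filterlim S (at_right 0) sequentially"
    using S pos by (auto simp: filterlim_at pos[THEN less_imp_neq, symmetric])
  from filterlim_compose[OF lim this]
  have L: "(\<lambda>n. integral\<^sup>L (lborel \<Otimes>\<^sub>M lborel) (outside (S n) f)) \<longlonglongrightarrow> L" .
  have mono: "mono (\<lambda>n. outside (S n) f z)" for z
  proof (rule monoI)
    fix m n :: nat assume "m \<le> n"
    then have "S n \<le> S m" by (simp add: S_def le_imp_inverse_le)
    then show "outside (S m) f z \<le> outside (S n) f z"
      using nonneg[of z] by (auto simp: outside_def indicator_def)
  qed
  show ?thesis
  proof (rule integrable_monotone_convergence[where f = "\<lambda>n. outside (S n) f" and x = L])
    show "integrable (lborel \<Otimes>\<^sub>M lborel) (outside (S n) f)" for n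
      by (rule int[OF pos])
    show "AE z in lborel \<Otimes>\<^sub>M lborel. mono (\<lambda>n. outside (S n) f z)"
      by (rule AE_I2) (rule mono)
    show "AE z in lborel \<Otimes>\<^sub>M lborel. (\<lambda>n. outside (S n) f z) \<longlonglongrightarrow> f z"
      by (rule AE_I2) (rule tendsto_outside[where f = f, OF f0 S])
  qed (rule L meas)+
qed

section \<open>Comparison of the two operators\<close>

lemma C2_const_times:
  assumes "0 < s * p"
  shows "C2_const n C1 s p * (pi powr (- real n / 2) * 2 powr (s * p) * Gamma ((real n + s * p) / 2)) = C1"
proof -
  have "Gamma ((real n + s * p) / 2) > 0" using assms by (intro Gamma_real_pos) (simp add: add_nonneg_pos)
  moreover have "pi powr (real n / 2) * pi powr (- real n / 2) = 1"
    by (simp add: powr_add[symmetric])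
  ultimately show ?thesis by (simp add: C2_const_def field_simps)
qed

lemma C2_const_pos:
  assumes "0 < s * p" "0 < C1"
  shows "0 < C2_const n C1 s p"
proof -
  have "Gamma ((real n + s * p) / 2) > 0" using assms by (intro Gamma_real_pos) (simp add: add_nonneg_pos)
  then show ?thesis using assms by (simp add: C2_const_def)
qed

locale kernel_comparison =
  fixes s p C1 R M :: real
    and \<Omega> :: "'a::euclidean_space set"
    and K :: "real \<Rightarrow> 'a \<Rightarrow> 'a \<Rightarrow> real"
    and u :: "'a \<Rightarrow> real"
  assumes sp: "0 < s * p" and C1: "0 < C1"
    and \<Omega>: "open \<Omega>" and R: "0 < R" "ball 0 R \<subseteq> \<Omega>"
    and K: "dirichlet_heat_kernel \<Omega> K"
    and measurable_Phi: "(\<lambda>y. Phi p (u 0 - u y)) \<in> borel_measurable borel"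
    and Phi_nonneg: "\<And>y. 0 \<le> Phi p (u 0 - u y)"
    and Phi_le: "\<And>y. Phi p (u 0 - u y) \<le> M"
    and Phi_pos: "\<And>y. y \<notin> \<Omega> \<Longrightarrow> 0 < Phi p (u 0 - u y)"
    and complement: "emeasure lborel (UNIV - \<Omega>) \<noteq> 0"
begin

definition g :: "'a \<Rightarrow> real" where "g y = Phi p (u 0 - u y)"

lemma measurable_g [measurable]: "g \<in> borel_measurable borel"
  using measurable_Phi by (simp add: g_def[abs_def])

lemma g_bounds: "0 \<le> g y" "g y \<le> M"
  by (simp_all add: g_def Phi_nonneg Phi_le)

lemma g_0: "g 0 = 0"
  by (simp add: g_def Phi_def)

lemma zero_in_domain: "0 \<in> \<Omega>"
  using R by auto

lemma measurable_domain [measurable]: "\<Omega> \<in> sets borel"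
  using \<Omega> by simp

lemma M_nonneg: "0 \<le> M"
  using g_bounds[of 0] by linarith

lemma kernel_bounds:
  assumes "0 < t" "y \<in> \<Omega>"
  shows "0 \<le> K t 0 y" "K t 0 y \<le> heat_kernel t 0 y"
  using dirichlet_kernel_bounds[OF \<Omega> K _ zero_in_domain] assms by auto

lemma measurable_kernel_slice:
  assumes t: "0 < t"
  shows "(\<lambda>y. indicator \<Omega> y * K t 0 y) \<in> borel_measurable borel"
proof -
  have "continuous_on \<Omega> ((\<lambda>(t, x, y). K t x y) \<circ> (\<lambda>y. (t, 0, y)))"
    using K t zero_in_domain unfolding dirichlet_heat_kernel_def
    by (intro continuous_on_compose continuous_intros) (auto elim: continuous_on_subset)
  then have "(\<lambda>y. indicator \<Omega> y *\<^sub>R K t 0 y) \<in> borel_measurable borel"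
    by (intro borel_measurable_continuous_on_indicator) (auto simp: o_def)
  then show ?thesis by simp
qed

lemma measurable_kernel:
  "(\<lambda>z. indicator ({0<..} \<times> \<Omega>) z * K (fst z) 0 (snd z)) \<in> borel_measurable (lborel \<Otimes>\<^sub>M lborel)"
proof -
  have "continuous_on ({0<..} \<times> \<Omega>) ((\<lambda>(t, x, y). K t x y) \<circ> (\<lambda>z. (fst z, 0, snd z)))"
    using K zero_in_domain unfolding dirichlet_heat_kernel_def
    by (intro continuous_on_compose continuous_intros) (auto elim!: continuous_on_subset)
  then have "(\<lambda>z. indicator ({0<..} \<times> \<Omega>) z *\<^sub>R K (fst z) 0 (snd z)) \<in> borel_measurable borel"
    using \<Omega> by (intro borel_measurable_continuous_on_indicator borel_open open_Times) (auto simp: o_def)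
  then show ?thesis
    by (simp add: borel_prod[symmetric] cong: measurable_cong_sets)
qed

abbreviation Hg :: "real \<Rightarrow> 'a \<Rightarrow> real" where "Hg \<equiv> \<lambda>t y. heat_kernel t 0 y * g y"
abbreviation Kg :: "real \<Rightarrow> 'a \<Rightarrow> real" where "Kg \<equiv> \<lambda>t y. K t 0 y * g y"
abbreviation Dg :: "real \<Rightarrow> 'a \<Rightarrow> real" where "Dg \<equiv> \<lambda>t y. (heat_kernel t 0 y - K t 0 y) * g y"
abbreviation \<sigma> :: real where "\<sigma> \<equiv> s * p"
abbreviation W :: "'a set \<Rightarrow> (real \<Rightarrow> 'a \<Rightarrow> real) \<Rightarrow> real \<times> 'a \<Rightarrow> real" where "W \<equiv> weighted (s * p)"

lemma Dg_nonneg: "0 < t \<Longrightarrow> y \<in> \<Omega> \<Longrightarrow> 0 \<le> Dg t y"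
  using kernel_bounds[of t y] g_bounds[of y] by simp

lemma Kg_nonneg: "0 < t \<Longrightarrow> y \<in> \<Omega> \<Longrightarrow> 0 \<le> Kg t y"
  using kernel_bounds[of t y] g_bounds[of y] by simp

lemma Hg_nonneg: "0 < t \<Longrightarrow> 0 \<le> Hg t y"
  using heat_kernel_pos[of t 0 y] g_bounds[of y] by simp

lemma Hg_le: "0 < t \<Longrightarrow> Hg t y \<le> M * heat_kernel t 0 y"
  using heat_kernel_pos[of t 0 y] g_bounds[of y] by simp

lemma Kg_le: "0 < t \<Longrightarrow> y \<in> \<Omega> \<Longrightarrow> Kg t y \<le> Hg t y"
  using kernel_bounds[of t y] g_bounds[of y] by (simp add: mult_right_mono)

lemma Dg_eq: "Dg t y = Hg t y - Kg t y"
  by (simp add: left_diff_distrib)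

lemma slice_integrable:
  assumes t: "0 < t" and meas: "(\<lambda>y. indicator A y *\<^sub>R F y) \<in> borel_measurable borel"
    and F: "\<And>y. y \<in> A \<Longrightarrow> 0 \<le> F y" "\<And>y. y \<in> A \<Longrightarrow> F y \<le> Hg t y"
  shows "set_integrable lborel A F" "(LINT y:A|lborel. F y) \<le> M"
proof -
  have le: "indicator A y *\<^sub>R F y \<le> M * heat_kernel t 0 y" for y
  proof (cases "y \<in> A")
    case True
    then show ?thesis using order_trans[OF F(2)[OF True] Hg_le[OF t]] by simp
  next
    case False
    then show ?thesis using M_nonneg heat_kernel_pos[OF t, of 0 y] by simp
  qed
  have "0 \<le> indicator A y *\<^sub>R F y" for y
    using F(1)[of y] by (auto simp: indicator_def)
  then have norm: "norm (indicator A y *\<^sub>R F y) \<le> norm (M * heat_kernel t 0 y)" for y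
    using le[of y] by (simp only: real_norm_def abs_of_nonneg)
  have H: "integrable lborel (\<lambda>y::'a. M * heat_kernel t 0 y)"
    by (intro integrable_mult_right heat_kernel_integrable t)
  show 1: "set_integrable lborel A F"
    unfolding set_integrable_def
    by (rule Bochner_Integration.integrable_bound[OF H]) (use meas norm in auto)
  have "(LINT y:A|lborel. F y) \<le> (\<integral>y. M * heat_kernel t (0::'a) y \<partial>lborel)"
    using 1 H le unfolding set_integrable_def set_lebesgue_integral_def by (intro integral_mono)
  then show "(LINT y:A|lborel. F y) \<le> M" by (simp add: heat_kernel_integral[OF t])
qed

lemma measurable_Kg_slice:
  assumes t: "0 < t" and A: "A \<in> sets borel" "A \<subseteq> \<Omega>"
  shows "(\<lambda>y. indicator A y *\<^sub>R Kg t y) \<in> borel_measurable borel"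
proof -
  have "(\<lambda>y. indicator A y *\<^sub>R Kg t y) = (\<lambda>y. indicator A y * ((indicator \<Omega> y * K t 0 y) * g y))"
    using A by (auto simp: indicator_def fun_eq_iff)
  then show ?thesis using measurable_kernel_slice[OF t] A(1) by simp
qed

lemma measurable_Dg_slice:
  assumes t: "0 < t" and A: "A \<in> sets borel" "A \<subseteq> \<Omega>"
  shows "(\<lambda>y. indicator A y *\<^sub>R Dg t y) \<in> borel_measurable borel"
proof -
  have [measurable]: "A \<in> sets borel" by fact
  have "(\<lambda>y. indicator A y *\<^sub>R Hg t y - indicator A y *\<^sub>R Kg t y) \<in> borel_measurable borel"
    by (intro borel_measurable_diff measurable_Kg_slice t A) measurable
  then show ?thesis by (simp add: left_diff_distrib right_diff_distrib)
qed

lemma Hg_slice: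
  assumes "0 < t" "A \<in> sets borel"
  shows "set_integrable lborel A (Hg t)" "(LINT y:A|lborel. Hg t y) \<le> M"
  using slice_integrable[of t A "Hg t"] assms Hg_nonneg by auto

lemma Kg_slice:
  assumes "0 < t" "A \<in> sets borel" "A \<subseteq> \<Omega>"
  shows "set_integrable lborel A (Kg t)" "(LINT y:A|lborel. Kg t y) \<le> M"
  using assms by (intro slice_integrable[of t A "Kg t"] measurable_Kg_slice Kg_nonneg Kg_le; auto)+

lemma Dg_slice:
  assumes "0 < t" "A \<in> sets borel" "A \<subseteq> \<Omega>"
  shows "set_integrable lborel A (Dg t)" "(LINT y:A|lborel. Dg t y) \<le> M"
proof -
  have "Dg t y \<le> Hg t y" if "y \<in> A" for y
    using Kg_nonneg[of t y] that assms by (auto simp: Dg_eq)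
  then show "set_integrable lborel A (Dg t)" "(LINT y:A|lborel. Dg t y) \<le> M"
    using slice_integrable[of t A "Dg t"] assms measurable_Dg_slice Dg_nonneg by (auto simp: subset_iff)
qed

lemma measurable_W_Hg:
  assumes [measurable]: "A \<in> sets borel"
  shows "W A Hg \<in> borel_measurable (lborel \<Otimes>\<^sub>M lborel)"
  unfolding weighted_def by measurable

lemma measurable_W_Kg:
  assumes A: "A \<in> sets borel" "A \<subseteq> \<Omega>"
  shows "W A Kg \<in> borel_measurable (lborel \<Otimes>\<^sub>M lborel)"
proof -
  note [measurable] = A(1) measurable_kernel
  have "W A Kg = (\<lambda>z. (indicator ({0<..} \<times> \<Omega>) z * K (fst z) 0 (snd z)) *
      (indicator A (snd z) * g (snd z) / fst z powr (1 + \<sigma> / 2)))"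
    using A(2) by (auto simp: weighted_def indicator_def fun_eq_iff)
  also have "\<dots> \<in> borel_measurable (lborel \<Otimes>\<^sub>M lborel)"
    by measurable
  finally show ?thesis .
qed

lemma W_Dg_eq: "W A Dg z = W A Hg z - W A Kg z"
  by (simp add: weighted_def split_beta left_diff_distrib right_diff_distrib diff_divide_distrib)

lemma measurable_W_Dg:
  assumes "A \<in> sets borel" "A \<subseteq> \<Omega>"
  shows "W A Dg \<in> borel_measurable (lborel \<Otimes>\<^sub>M lborel)"
  unfolding W_Dg_eq[abs_def] by (intro borel_measurable_diff measurable_W_Hg measurable_W_Kg assms)

lemma integrable_W_Hg_of_growth:
  assumes A: "A \<in> sets borel" and a: "\<sigma> / 2 < a"
    and g: "\<And>y. y \<in> A \<Longrightarrow> g y \<le> D * norm y powr (2 * a)"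
  shows "integrable (lborel \<Otimes>\<^sub>M lborel) (W A Hg)"
proof -
  have a0: "0 \<le> a" using a sp by linarith
  obtain C where C: "0 < C" "\<And>t (x::'a). 0 < t \<Longrightarrow>
       (\<integral>\<^sup>+y. ennreal (heat_kernel t x y * norm (x - y) powr (2 * a)) \<partial>lborel) \<le> ennreal (C * t powr a)"
    using heat_kernel_moment[OF a0] by blast
  define D' where "D' = max D 0"
  have D': "0 \<le> D'" "\<And>y. y \<in> A \<Longrightarrow> g y \<le> D' * norm y powr (2 * a)"
    by (auto simp: D'_def intro!: order_trans[OF g] mult_right_mono)
  show ?thesis
  proof (rule weighted_integrableI[OF sp a measurable_W_Hg[OF A] Hg_nonneg Hg_slice(1)[OF _ A] Hg_slice(2)[OF _ A]])
    fix t :: real assume t: "0 < t"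
    let ?h = "\<lambda>y::'a. heat_kernel t 0 y * norm (0 - y) powr (2 * a)"
    have "norm (?h y) = ?h y" for y
      using heat_kernel_pos[OF t, of 0 y] by (simp add: abs_mult)
    then have "integrable lborel ?h"
      using le_less_trans[OF C(2)[OF t, of 0] ennreal_less_top]
      by (intro integrableI_bounded) simp_all
    then have int: "integrable lborel (\<lambda>y. D' * ?h y)" by (rule integrable_mult_right)
    have mom: "(\<integral>y. ?h y \<partial>lborel) \<le> C * t powr a"
      using C(1) t C(2)[OF t, of 0]
      by (subst integral_eq_nn_integral) (auto intro!: enn2real_leI simp: heat_kernel_pos[OF t] less_imp_le)
    have "indicator A y *\<^sub>R Hg t y \<le> D' * ?h y" for y
    proof (cases "y \<in> A")
      case True
      then show ?thesis
        using mult_left_mono[OF D'(2)[OF True], of "heat_kernel t 0 y"] heat_kernel_pos[OF t, of 0 y]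
        by (simp add: mult_ac)
    next
      case False
      then show ?thesis using D'(1) heat_kernel_pos[OF t, of 0 y] by simp
    qed
    then have "(LINT y:A|lborel. Hg t y) \<le> (\<integral>y. D' * ?h y \<partial>lborel)"
      using Hg_slice(1)[OF t A] int unfolding set_integrable_def set_lebesgue_integral_def
      by (intro integral_mono)
    also have "\<dots> \<le> D' * (C * t powr a)" using mom D'(1) by (simp add: mult_left_mono)
    finally show "(LINT y:A|lborel. Hg t y) \<le> (D' * C) * t powr a" by (simp add: mult_ac)
  qed
qed

lemma integrable_W_Hg_away:
  assumes A: "A \<in> sets borel" "0 < \<epsilon>" "\<And>y. y \<in> A \<Longrightarrow> \<epsilon> \<le> norm y"
  shows "integrable (lborel \<Otimes>\<^sub>M lborel) (W A Hg)"
proof (rule integrable_W_Hg_of_growth[OF A(1), where a = "\<sigma>" and D = "M / \<epsilon> powr (2 * \<sigma>)"])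
  show "\<sigma> / 2 < \<sigma>" using sp by linarith
  fix y assume "y \<in> A"
  then have "\<epsilon> powr (2 * \<sigma>) \<le> norm y powr (2 * \<sigma>)"
    using A sp by (intro powr_mono2) auto
  then have "M * \<epsilon> powr (2 * \<sigma>) \<le> M * norm y powr (2 * \<sigma>)" using M_nonneg by (rule mult_left_mono)
  then have "M \<le> M / \<epsilon> powr (2 * \<sigma>) * norm y powr (2 * \<sigma>)" using A(2) by (simp add: field_simps)
  then show "g y \<le> M / \<epsilon> powr (2 * \<sigma>) * norm y powr (2 * \<sigma>)" using g_bounds(2)[of y] by linarith
qed

lemma integrable_W_complement: "integrable (lborel \<Otimes>\<^sub>M lborel) (W (UNIV - \<Omega>) Hg)"
proof (rule integrable_W_Hg_away[OF _ R(1)])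
  show "R \<le> norm y" if "y \<in> UNIV - \<Omega>" for y
  proof -
    have "y \<notin> ball 0 R" using that R(2) by blast
    then show ?thesis by simp
  qed
qed measurable

text \<open>Near the origin the two kernels agree up to any power of \<open>t\<close>, since the boundary is at
  distance at least \<open>R / 2\<close>; away from it the heat kernel itself is that small.\<close>

lemma integrable_W_Dg: "integrable (lborel \<Otimes>\<^sub>M lborel) (W \<Omega> Dg)"
proof -
  define N where "N = \<Omega> \<inter> cball 0 (R / 2)"
  define F where "F = \<Omega> - cball 0 (R / 2)"
  have sets: "N \<in> sets borel" "F \<in> sets borel" "N \<subseteq> \<Omega>" "F \<subseteq> \<Omega>"
    using \<Omega> by (auto simp: N_def F_def)
  have "0 < \<sigma>" by (rule sp)
  obtain C where C: "0 < C" "\<And>t r x y. 0 < t \<Longrightarrow> 0 < r \<Longrightarrow> x \<in> \<Omega> \<Longrightarrow> y \<in> \<Omega> \<Longrightarrow>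
    (\<And>z. z \<in> frontier \<Omega> \<Longrightarrow> r \<le> norm (z - y)) \<Longrightarrow>
    heat_kernel t x y - C * t powr \<sigma> / r powr (real DIM('a) + 2 * \<sigma>) \<le> K t x y"
    using dirichlet_kernel_ge[OF \<Omega> K \<open>0 < \<sigma>\<close>] by blast
  define E where "E = C / (R / 2) powr (real DIM('a) + 2 * \<sigma>)"
  have E: "0 \<le> E" using C(1) R by (simp add: E_def)
  have near: "Dg t y \<le> E * t powr \<sigma> * M" if t: "0 < t" and y: "y \<in> N" for t y
  proof -
    have "R / 2 \<le> norm (z - y)" if "z \<in> frontier \<Omega>" for z
    proof -
      have "z \<notin> ball 0 R"
        using that \<Omega> R(2) by (auto simp: frontier_def interior_open)
      then have "R \<le> norm z" by simp
      moreover have "norm y \<le> R / 2" using y by (simp add: N_def)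
      ultimately show ?thesis using norm_triangle_ineq2[of z y] by linarith
    qed
    then have "heat_kernel t 0 y - K t 0 y \<le> E * t powr \<sigma>"
      using C(2)[of t "R / 2" 0 y] t R y zero_in_domain by (simp add: E_def N_def)
    moreover have "0 \<le> heat_kernel t 0 y - K t 0 y"
      using kernel_bounds[of t y] t y by (simp add: N_def)
    ultimately show ?thesis
      using g_bounds[of y] E by (intro mult_mono) auto
  qed
  have N: "integrable (lborel \<Otimes>\<^sub>M lborel) (W N Dg)"
  proof (rule weighted_integrableI[OF sp _ measurable_W_Dg[OF sets(1,3)] _ Dg_slice(1)[OF _ sets(1,3)] Dg_slice(2)[OF _ sets(1,3)]])
    show "\<sigma> / 2 < \<sigma>" using sp by linarith
    show "0 \<le> Dg t y" if "0 < t" "y \<in> N" for t y using Dg_nonneg that sets(3) by blast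
    fix t :: real assume t: "0 < t"
    define V where "V = measure lborel (cball (0::'a) (R / 2))"
    have cb: "integrable lborel (\<lambda>y::'a. indicator (cball 0 (R / 2)) y * (E * t powr \<sigma> * M))"
      by (intro integrable_mult_left integrable_real_indicator emeasure_lborel_cball_finite) auto
    have "(LINT y:N|lborel. Dg t y) \<le> (\<integral>y. indicator (cball (0::'a) (R / 2)) y * (E * t powr \<sigma> * M) \<partial>lborel)"
      unfolding set_lebesgue_integral_def
    proof (rule integral_mono[OF Dg_slice(1)[OF t sets(1,3), unfolded set_integrable_def] cb])
      fix y :: 'a
      show "indicator N y *\<^sub>R Dg t y \<le> indicator (cball 0 (R / 2)) y * (E * t powr \<sigma> * M)"
      proof (cases "y \<in> N")
        case True
        then have "y \<in> cball 0 (R / 2)" by (simp add: N_def)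
        then show ?thesis using near[OF t True] True by (simp only: indicator_simps) simp
      next
        case False
        then show ?thesis using E M_nonneg by simp
      qed
    qed
    also have "\<dots> = V * (E * t powr \<sigma> * M)" by (simp add: V_def)
    finally show "(LINT y:N|lborel. Dg t y) \<le> (V * E * M) * t powr \<sigma>" by (simp add: mult_ac)
  qed
  have F: "integrable (lborel \<Otimes>\<^sub>M lborel) (W F Hg)"
    using R by (intro integrable_W_Hg_away[OF sets(2), of "R / 2"]) (auto simp: F_def)
  have split: "W \<Omega> Dg = (\<lambda>z. W N Dg z + W F Dg z)"
    by (auto simp: weighted_def N_def F_def indicator_def fun_eq_iff)
  have "integrable (lborel \<Otimes>\<^sub>M lborel) (W F Dg)"
  proof (rule Bochner_Integration.integrable_bound[OF F measurable_W_Dg[OF sets(2,4)]])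
    have "\<bar>Dg t y\<bar> \<le> \<bar>Hg t y\<bar>" if "0 < t" "y \<in> \<Omega>" for t y
      using Dg_nonneg[OF that] Kg_nonneg[OF that] Dg_eq[of t y] by linarith
    then show "AE z in lborel \<Otimes>\<^sub>M lborel. norm (W F Dg z) \<le> norm (W F Hg z)"
      using sets(4) by (auto simp: weighted_def indicator_def abs_mult subset_iff intro!: AE_I2 divide_right_mono split: prod.split)
  qed
  with N show ?thesis unfolding split by (rule Bochner_Integration.integrable_add)
qed

lemma iterated_integrable_W_iff:
  assumes "W A F \<in> borel_measurable (lborel \<Otimes>\<^sub>M lborel)"
    and "\<And>t y. 0 < t \<Longrightarrow> y \<in> A \<Longrightarrow> 0 \<le> F t y"
    and "\<And>t. 0 < t \<Longrightarrow> set_integrable lborel A (F t)"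
  shows "iterated_integrable s p A F \<longleftrightarrow> integrable (lborel \<Otimes>\<^sub>M lborel) (W A F)"
  unfolding iterated_integrable_def using weighted_integrable_iff[OF assms] assms(3) by blast

definition c2 :: real where "c2 = C2_const DIM('a) C1 s p"

lemma c2_pos: "0 < c2"
  unfolding c2_def by (rule C2_const_pos[OF sp C1])

definition rhs :: real where
  "rhs = c2 * (LINT t:{0<..}|lborel. (LINT y:\<Omega>|lborel. Dg t y) / t powr (1 + s * p / 2)) +
     c2 * (LINT t:{0<..}|lborel. (LINT y:UNIV - \<Omega>|lborel. Hg t y) / t powr (1 + s * p / 2))"

lemma rhs_eq: "rhs = c2 * (integral\<^sup>L (lborel \<Otimes>\<^sub>M lborel) (W \<Omega> Dg) +
    integral\<^sup>L (lborel \<Otimes>\<^sub>M lborel) (W (UNIV - \<Omega>) Hg))"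
  unfolding rhs_def
  by (simp only: iterated_integral_eq_weighted[OF integrable_W_Dg]
      iterated_integral_eq_weighted[OF integrable_W_complement] distrib_left)

lemma iterated_integrable_Dg: "iterated_integrable s p \<Omega> Dg"
proof (rule iterated_integrable_W_iff[THEN iffD2])
  show "W \<Omega> Dg \<in> borel_measurable (lborel \<Otimes>\<^sub>M lborel)"
    by (rule measurable_W_Dg) auto
  show "0 \<le> Dg t y" if "0 < t" "y \<in> \<Omega>" for t y using that by (rule Dg_nonneg)
  show "set_integrable lborel \<Omega> (Dg t)" if "0 < t" for t using that by (rule Dg_slice(1)) auto
qed (rule integrable_W_Dg)

lemma iterated_integrable_complement: "iterated_integrable s p (UNIV - \<Omega>) Hg"
proof (rule iterated_integrable_W_iff[THEN iffD2])
  show "W (UNIV - \<Omega>) Hg \<in> borel_measurable (lborel \<Otimes>\<^sub>M lborel)"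
    by (rule measurable_W_Hg) measurable
  show "0 \<le> Hg t y" if "0 < t" for t y using that by (rule Hg_nonneg)
  show "set_integrable lborel (UNIV - \<Omega>) (Hg t)" if "0 < t" for t
    using that by (rule Hg_slice(1)) measurable
qed (rule integrable_W_complement)

lemma rhs_pos: "0 < rhs"
proof -
  let ?c = "W (UNIV - \<Omega>) Hg"
  have nonneg: "0 \<le> ?c z" for z
    using Hg_nonneg by (auto simp: weighted_def indicator_def split: prod.split)
  have "0 \<le> W \<Omega> Dg z" for z
    using Dg_nonneg by (auto simp: weighted_def indicator_def split: prod.split)
  then have 1: "0 \<le> integral\<^sup>L (lborel \<Otimes>\<^sub>M lborel) (W \<Omega> Dg)" by simp
  have "integral\<^sup>L (lborel \<Otimes>\<^sub>M lborel) ?c \<noteq> 0"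
  proof
    assume "integral\<^sup>L (lborel \<Otimes>\<^sub>M lborel) ?c = 0"
    then have ae: "AE z in lborel \<Otimes>\<^sub>M lborel. ?c z = 0"
      using integral_nonneg_eq_0_iff_AE[OF integrable_W_complement] nonneg by simp
    have pos: "?c z = 0 \<Longrightarrow> z \<notin> {0::real<..} \<times> (UNIV - \<Omega>)" for z
      using Phi_pos[of "snd z"] heat_kernel_pos[of "fst z" 0 "snd z"]
      by (auto simp: weighted_def g_def)
    have "AE z in lborel \<Otimes>\<^sub>M lborel. z \<notin> {0::real<..} \<times> (UNIV - \<Omega>)"
      by (rule eventually_mono[OF ae]) (rule pos)
    then have "emeasure (lborel \<Otimes>\<^sub>M lborel) ({0::real<..} \<times> (UNIV - \<Omega>)) = 0"
      by (subst (asm) AE_iff_measurable[OF _ refl]) (auto simp: space_pair_measure)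
    then have "emeasure lborel {0::real<..} * emeasure lborel (UNIV - \<Omega>) = 0"
      by (subst (asm) lborel.emeasure_pair_measure_Times) auto
    moreover have "emeasure lborel {0::real<..<1} \<le> emeasure lborel {0::real<..}"
      by (intro emeasure_mono) auto
    ultimately show False using complement by auto
  qed
  moreover have "0 \<le> integral\<^sup>L (lborel \<Otimes>\<^sub>M lborel) ?c" using nonneg by simp
  ultimately show ?thesis
    unfolding rhs_eq using 1 c2_pos by (intro mult_pos_pos) auto
qed

lemma W_UNIV_eq: "W UNIV Hg z = W \<Omega> Kg z + (W \<Omega> Dg z + W (UNIV - \<Omega>) Hg z)"
  unfolding W_Dg_eq by (auto simp: weighted_def indicator_def split: prod.split)

lemma integrable_W_Hg_iff:
  "integrable (lborel \<Otimes>\<^sub>M lborel) (W UNIV Hg) \<longleftrightarrow> integrable (lborel \<Otimes>\<^sub>M lborel) (W \<Omega> Kg)"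
proof -
  have DH: "integrable (lborel \<Otimes>\<^sub>M lborel) (\<lambda>z. W \<Omega> Dg z + W (UNIV - \<Omega>) Hg z)"
    by (intro Bochner_Integration.integrable_add integrable_W_Dg integrable_W_complement)
  have eq: "W UNIV Hg = (\<lambda>z. W \<Omega> Kg z + (W \<Omega> Dg z + W (UNIV - \<Omega>) Hg z))"
    using W_UNIV_eq by blast
  have eq': "W \<Omega> Kg = (\<lambda>z. W UNIV Hg z - (W \<Omega> Dg z + W (UNIV - \<Omega>) Hg z))"
    unfolding W_UNIV_eq by simp
  show ?thesis
  proof
    assume "integrable (lborel \<Otimes>\<^sub>M lborel) (W UNIV Hg)"
    from Bochner_Integration.integrable_diff[OF this DH]
    show "integrable (lborel \<Otimes>\<^sub>M lborel) (W \<Omega> Kg)" by (simp only: eq'[symmetric])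
  next
    assume "integrable (lborel \<Otimes>\<^sub>M lborel) (W \<Omega> Kg)"
    from Bochner_Integration.integrable_add[OF this DH]
    show "integrable (lborel \<Otimes>\<^sub>M lborel) (W UNIV Hg)" by (simp only: eq[symmetric])
  qed
qed

lemma W_at_0: "W A Hg (t, 0) = 0"
  by (simp add: weighted_def g_0)

lemma outside_W: "outside \<epsilon> (W A F) = W (A \<inter> {y. norm (0 - y) > \<epsilon>}) F"
  by (auto simp: outside_def weighted_def indicator_def fun_eq_iff)

lemma integrable_outside_Hg:
  assumes "0 < \<epsilon>"
  shows "integrable (lborel \<Otimes>\<^sub>M lborel) (outside \<epsilon> (W UNIV Hg))"
  unfolding outside_W by (rule integrable_W_Hg_away[OF _ assms]) auto

lemma integrable_outside_Kg:
  assumes "0 < \<epsilon>"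
  shows "integrable (lborel \<Otimes>\<^sub>M lborel) (outside \<epsilon> (W \<Omega> Kg))"
proof (rule Bochner_Integration.integrable_bound[OF integrable_outside_Hg[OF assms]])
  show "outside \<epsilon> (W \<Omega> Kg) \<in> borel_measurable (lborel \<Otimes>\<^sub>M lborel)"
    by (intro outside_measurable measurable_W_Kg) auto
  have "\<bar>Kg t y\<bar> \<le> \<bar>Hg t y\<bar>" if "0 < t" "y \<in> \<Omega>" for t y
    using Kg_nonneg[OF that] Kg_le[OF that] by linarith
  then show "AE z in lborel \<Otimes>\<^sub>M lborel. norm (outside \<epsilon> (W \<Omega> Kg) z) \<le> norm (outside \<epsilon> (W UNIV Hg) z)"
    by (auto simp: outside_def weighted_def indicator_def abs_mult intro!: AE_I2 divide_right_mono split: prod.split)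
qed

lemma frac_trunc:
  assumes \<epsilon>: "0 < \<epsilon>"
  shows "frac_p_laplacian_trunc_defined s p u 0 \<epsilon>"
    "frac_p_laplacian_trunc C1 s p u 0 \<epsilon> = c2 * integral\<^sup>L (lborel \<Otimes>\<^sub>M lborel) (outside \<epsilon> (W UNIV Hg))"
proof -
  define A where "A = {y::'a. norm (0 - y) > \<epsilon>}"
  define \<kappa> where "\<kappa> = pi powr (- real DIM('a) / 2) * 2 powr (s * p) * Gamma ((real DIM('a) + s * p) / 2)"
  define q where "q = (\<lambda>y. indicator A y *\<^sub>R (g y / norm (0 - y) powr (real DIM('a) + s * p)))"
  have \<kappa>: "c2 * \<kappa> = C1" unfolding c2_def \<kappa>_def by (rule C2_const_times[OF sp])
  have "\<kappa> \<noteq> 0" using \<kappa> C1 by auto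
  have slice: "(\<integral>t. outside \<epsilon> (W UNIV Hg) (t, y) \<partial>lborel) = \<kappa> * q y" for y
  proof (cases "y \<in> A")
    case True
    then have "0 \<noteq> y" using \<epsilon> by (auto simp: A_def)
    from heat_kernel_time_integral[OF sp this]
    have *: "(\<integral>t. indicator {0<..} t * (heat_kernel t 0 y / t powr (1 + s * p / 2)) \<partial>lborel)
       = \<kappa> / norm (0 - y) powr (real DIM('a) + s * p)"
      unfolding \<kappa>_def by (rule has_bochner_integral_integral_eq)
    have "outside \<epsilon> (W UNIV Hg) (t, y) = g y * (indicator {0<..} t * (heat_kernel t 0 y / t powr (1 + s * p / 2)))" for t
      using True by (simp add: outside_def A_def weighted_def)
    then show ?thesis using True by (simp only: integral_mult_right_zero *) (simp add: q_def)
  next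
    case False
    then have "outside \<epsilon> (W UNIV Hg) (t, y) = 0" for t
      by (simp add: outside_def A_def)
    then show ?thesis using False by (simp add: q_def)
  qed
  note int = integrable_outside_Hg[OF \<epsilon>]
  have "integrable lborel (\<lambda>y. \<kappa> * q y)"
    using lborel_pair.integrable_snd[of "\<lambda>t y. outside \<epsilon> (W UNIV Hg) (t, y)"] int by (simp add: slice)
  from integrable_mult_right[OF this, of "1 / \<kappa>"] have "integrable lborel q"
    using \<open>\<kappa> \<noteq> 0\<close> by (simp del: integrable_mult_right_iff)
  then show "frac_p_laplacian_trunc_defined s p u 0 \<epsilon>"
    by (simp add: frac_p_laplacian_trunc_defined_def set_integrable_def q_def A_def g_def)
  have "frac_p_laplacian_trunc C1 s p u 0 \<epsilon> = C1 * integral\<^sup>L lborel q"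
    unfolding frac_p_laplacian_trunc_def set_lebesgue_integral_def q_def A_def g_def ..
  also have "\<dots> = c2 * (\<kappa> * integral\<^sup>L lborel q)"
    using \<kappa> by (simp only: mult.assoc[symmetric])
  also have "\<kappa> * integral\<^sup>L lborel q = (\<integral>y. (\<integral>t. outside \<epsilon> (W UNIV Hg) (t, y) \<partial>lborel) \<partial>lborel)"
    by (simp add: slice)
  also have "\<dots> = integral\<^sup>L (lborel \<Otimes>\<^sub>M lborel) (outside \<epsilon> (W UNIV Hg))"
    using lborel_pair.integral_snd[of "\<lambda>t y. outside \<epsilon> (W UNIV Hg) (t, y)"] int by simp
  finally show "frac_p_laplacian_trunc C1 s p u 0 \<epsilon> =
    c2 * integral\<^sup>L (lborel \<Otimes>\<^sub>M lborel) (outside \<epsilon> (W UNIV Hg))" .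
qed

lemma spec_trunc:
  assumes \<epsilon>: "0 < \<epsilon>"
  shows "spec_p_laplacian_trunc_defined s p \<Omega> K u 0 \<epsilon>"
    "spec_p_laplacian_trunc C1 s p \<Omega> K u 0 \<epsilon> = c2 * integral\<^sup>L (lborel \<Otimes>\<^sub>M lborel) (outside \<epsilon> (W \<Omega> Kg))"
proof -
  define A where "A = \<Omega> \<inter> {y::'a. norm (0 - y) > \<epsilon>}"
  have A: "A \<in> sets borel" "A \<subseteq> \<Omega>" by (auto simp: A_def)
  have int: "integrable (lborel \<Otimes>\<^sub>M lborel) (W A Kg)"
    using integrable_outside_Kg[OF \<epsilon>] by (simp only: outside_W A_def)
  have "iterated_integrable s p A Kg"
    using iterated_integrable_W_iff[of A Kg, OF measurable_W_Kg[OF A] _ Kg_slice(1)[OF _ A]]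
      Kg_nonneg A(2) int by blast
  then show "spec_p_laplacian_trunc_defined s p \<Omega> K u 0 \<epsilon>"
    by (simp only: spec_p_laplacian_trunc_defined_def A_def g_def)
  show "spec_p_laplacian_trunc C1 s p \<Omega> K u 0 \<epsilon> = c2 * integral\<^sup>L (lborel \<Otimes>\<^sub>M lborel) (outside \<epsilon> (W \<Omega> Kg))"
    using iterated_integral_eq_weighted[OF int]
    by (simp only: spec_p_laplacian_trunc_def outside_W A_def g_def c2_def)
qed

lemma spec_defined_iff:
  "spec_p_laplacian_defined s p \<Omega> K u 0 \<longleftrightarrow> integrable (lborel \<Otimes>\<^sub>M lborel) (W UNIV Hg)"
proof -
  have "iterated_integrable s p \<Omega> Kg \<longleftrightarrow> integrable (lborel \<Otimes>\<^sub>M lborel) (W \<Omega> Kg)"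
  proof (rule iterated_integrable_W_iff)
    show "W \<Omega> Kg \<in> borel_measurable (lborel \<Otimes>\<^sub>M lborel)"
      by (rule measurable_W_Kg) auto
    show "0 \<le> Kg t y" if "0 < t" "y \<in> \<Omega>" for t y using that by (rule Kg_nonneg)
    show "set_integrable lborel \<Omega> (Kg t)" if "0 < t" for t using that by (rule Kg_slice(1)) auto
  qed
  moreover have "spec_p_laplacian_defined s p \<Omega> K u 0 \<longleftrightarrow> iterated_integrable s p \<Omega> Kg"
    by (simp only: spec_p_laplacian_defined_def g_def)
  ultimately show ?thesis by (simp only: integrable_W_Hg_iff)
qed

lemma frac_tendsto:
  assumes "integrable (lborel \<Otimes>\<^sub>M lborel) (W UNIV Hg)"
  shows "(frac_p_laplacian_trunc C1 s p u 0 \<longlongrightarrow>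
    c2 * integral\<^sup>L (lborel \<Otimes>\<^sub>M lborel) (W UNIV Hg)) (at_right 0)"
proof (rule Lim_transform_eventually)
  show "((\<lambda>\<epsilon>. c2 * integral\<^sup>L (lborel \<Otimes>\<^sub>M lborel) (outside \<epsilon> (W UNIV Hg))) \<longlongrightarrow>
    c2 * integral\<^sup>L (lborel \<Otimes>\<^sub>M lborel) (W UNIV Hg)) (at_right 0)"
    by (intro tendsto_mult tendsto_const tendsto_integral_outside assms W_at_0)
  show "\<forall>\<^sub>F \<epsilon> in at_right 0. c2 * integral\<^sup>L (lborel \<Otimes>\<^sub>M lborel) (outside \<epsilon> (W UNIV Hg)) =
      frac_p_laplacian_trunc C1 s p u 0 \<epsilon>"
    by (rule eventually_mono[OF eventually_at_right_less[of 0]]) (simp add: frac_trunc(2))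
qed

lemma frac_defined_iff:
  "frac_p_laplacian_defined C1 s p u 0 \<longleftrightarrow> integrable (lborel \<Otimes>\<^sub>M lborel) (W UNIV Hg)"
proof
  assume "integrable (lborel \<Otimes>\<^sub>M lborel) (W UNIV Hg)"
  then show "frac_p_laplacian_defined C1 s p u 0"
    unfolding frac_p_laplacian_defined_def using frac_trunc(1) frac_tendsto by blast
next
  assume "frac_p_laplacian_defined C1 s p u 0"
  then obtain L where L: "(frac_p_laplacian_trunc C1 s p u 0 \<longlongrightarrow> L) (at_right 0)"
    unfolding frac_p_laplacian_defined_def by blast
  have "((\<lambda>\<epsilon>. integral\<^sup>L (lborel \<Otimes>\<^sub>M lborel) (outside \<epsilon> (W UNIV Hg))) \<longlongrightarrow> L / c2) (at_right 0)"
  proof (rule Lim_transform_eventually)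
    show "((\<lambda>\<epsilon>. frac_p_laplacian_trunc C1 s p u 0 \<epsilon> / c2) \<longlongrightarrow> L / c2) (at_right 0)"
      using c2_pos by (intro tendsto_divide L tendsto_const) auto
    show "\<forall>\<^sub>F \<epsilon> in at_right 0. frac_p_laplacian_trunc C1 s p u 0 \<epsilon> / c2 =
        integral\<^sup>L (lborel \<Otimes>\<^sub>M lborel) (outside \<epsilon> (W UNIV Hg))"
      using c2_pos by (intro eventually_mono[OF eventually_at_right_less[of 0]]) (simp add: frac_trunc(2))
  qed
  moreover have "0 \<le> W UNIV Hg z" for z
    using Hg_nonneg by (auto simp: weighted_def indicator_def split: prod.split)
  ultimately show "integrable (lborel \<Otimes>\<^sub>M lborel) (W UNIV Hg)"
    by (intro integrable_of_tendsto_outside[where f = "W UNIV Hg"] measurable_W_Hg W_at_0 integrable_outside_Hg) auto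
qed

lemma difference_eq_rhs:
  assumes "frac_p_laplacian_defined C1 s p u 0"
  shows "frac_p_laplacian C1 s p u 0 - spec_p_laplacian C1 s p \<Omega> K u 0 = rhs"
proof -
  have int: "integrable (lborel \<Otimes>\<^sub>M lborel) (W UNIV Hg)" "integrable (lborel \<Otimes>\<^sub>M lborel) (W \<Omega> Kg)"
    using assms frac_defined_iff integrable_W_Hg_iff by auto
  have "frac_p_laplacian C1 s p u 0 = c2 * integral\<^sup>L (lborel \<Otimes>\<^sub>M lborel) (W UNIV Hg)"
    unfolding frac_p_laplacian_def by (intro tendsto_Lim frac_tendsto int) simp
  moreover have "spec_p_laplacian C1 s p \<Omega> K u 0 = c2 * integral\<^sup>L (lborel \<Otimes>\<^sub>M lborel) (W \<Omega> Kg)"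
    using iterated_integral_eq_weighted[OF int(2)]
    by (simp only: spec_p_laplacian_def heat_semigroup_def g_def c2_def)
  moreover have "integral\<^sup>L (lborel \<Otimes>\<^sub>M lborel) (W UNIV Hg) = integral\<^sup>L (lborel \<Otimes>\<^sub>M lborel) (W \<Omega> Kg) +
     (integral\<^sup>L (lborel \<Otimes>\<^sub>M lborel) (W \<Omega> Dg) + integral\<^sup>L (lborel \<Otimes>\<^sub>M lborel) (W (UNIV - \<Omega>) Hg))"
    unfolding W_UNIV_eq[abs_def] using int(2) integrable_W_Dg integrable_W_complement
    by (simp only: Bochner_Integration.integral_add Bochner_Integration.integrable_add)
  ultimately show ?thesis by (simp add: rhs_eq algebra_simps)
qed

lemma tendsto_difference_trunc:
  "((\<lambda>\<epsilon>. frac_p_laplacian_trunc C1 s p u 0 \<epsilon> - spec_p_laplacian_trunc C1 s p \<Omega> K u 0 \<epsilon>) \<longlongrightarrow> rhs) (at_right 0)"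
proof (rule Lim_transform_eventually)
  define f where "f = (\<lambda>z. W \<Omega> Dg z + W (UNIV - \<Omega>) Hg z)"
  have f: "integrable (lborel \<Otimes>\<^sub>M lborel) f"
    unfolding f_def by (intro Bochner_Integration.integrable_add integrable_W_Dg integrable_W_complement)
  have "integral\<^sup>L (lborel \<Otimes>\<^sub>M lborel) f = integral\<^sup>L (lborel \<Otimes>\<^sub>M lborel) (W \<Omega> Dg) +
     integral\<^sup>L (lborel \<Otimes>\<^sub>M lborel) (W (UNIV - \<Omega>) Hg)"
    unfolding f_def by (intro Bochner_Integration.integral_add integrable_W_Dg integrable_W_complement)
  then have rhs: "rhs = c2 * integral\<^sup>L (lborel \<Otimes>\<^sub>M lborel) f" by (simp add: rhs_eq)
  show "((\<lambda>\<epsilon>. c2 * integral\<^sup>L (lborel \<Otimes>\<^sub>M lborel) (outside \<epsilon> f)) \<longlongrightarrow> rhs) (at_right 0)"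
    unfolding rhs
  proof (intro tendsto_mult tendsto_const tendsto_integral_outside f)
    show "f (t, 0) = 0" for t by (simp add: f_def weighted_def g_0)
  qed
  show "\<forall>\<^sub>F \<epsilon> in at_right 0. c2 * integral\<^sup>L (lborel \<Otimes>\<^sub>M lborel) (outside \<epsilon> f) =
      frac_p_laplacian_trunc C1 s p u 0 \<epsilon> - spec_p_laplacian_trunc C1 s p \<Omega> K u 0 \<epsilon>"
  proof (rule eventually_mono[OF eventually_at_right_less[of 0]])
    fix \<epsilon> :: real assume \<epsilon>: "0 < \<epsilon>"
    have "outside \<epsilon> f z = outside \<epsilon> (W UNIV Hg) z - outside \<epsilon> (W \<Omega> Kg) z" for z
      unfolding outside_def f_def W_UNIV_eq right_diff_distrib[symmetric] by simp
    then have eq: "outside \<epsilon> f = (\<lambda>z. outside \<epsilon> (W UNIV Hg) z - outside \<epsilon> (W \<Omega> Kg) z)"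
      by (rule ext)
    have "integral\<^sup>L (lborel \<Otimes>\<^sub>M lborel) (outside \<epsilon> f) =
        integral\<^sup>L (lborel \<Otimes>\<^sub>M lborel) (outside \<epsilon> (W UNIV Hg)) - integral\<^sup>L (lborel \<Otimes>\<^sub>M lborel) (outside \<epsilon> (W \<Omega> Kg))"
      unfolding eq by (rule Bochner_Integration.integral_diff[OF integrable_outside_Hg[OF \<epsilon>] integrable_outside_Kg[OF \<epsilon>]])
    then show "c2 * integral\<^sup>L (lborel \<Otimes>\<^sub>M lborel) (outside \<epsilon> f) =
      frac_p_laplacian_trunc C1 s p u 0 \<epsilon> - spec_p_laplacian_trunc C1 s p \<Omega> K u 0 \<epsilon>"
      using frac_trunc(2)[OF \<epsilon>] spec_trunc(2)[OF \<epsilon>] by (simp add: right_diff_distrib)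
  qed
qed

lemma frac_defined_of_growth:
  assumes "s * p / 2 < a" "\<And>y. Phi p (u 0 - u y) \<le> D * norm y powr (2 * a)"
  shows "frac_p_laplacian_defined C1 s p u 0"
  unfolding frac_defined_iff using assms by (intro integrable_W_Hg_of_growth) (auto simp: g_def)

end

section \<open>The main theorem\<close>

lemma Ck_on_const: "Ck_on k (\<lambda>_. c) S"
  by (induction k arbitrary: c) auto

lemma Ck_on_add:
  assumes "Ck_on k f UNIV" "Ck_on k g UNIV"
  shows "Ck_on k (\<lambda>x. f x + g x) UNIV"
  using assms
proof (induction k arbitrary: f g)
  case 0
  then show ?case by (auto intro: continuous_intros)
next
  case (Suc k)
  then have d: "f differentiable at x" "g differentiable at x" for x by auto
  have "frechet_derivative (\<lambda>x. f x + g x) (at x) i =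
      frechet_derivative f (at x) i + frechet_derivative g (at x) i" for x i
  proof -
    have "((\<lambda>x. f x + g x) has_derivative
        (\<lambda>h. frechet_derivative f (at x) h + frechet_derivative g (at x) h)) (at x)"
      using d[of x] unfolding frechet_derivative_works by (rule has_derivative_add)
    from frechet_derivative_at[OF this] show ?thesis by (simp add: fun_eq_iff)
  qed
  then show ?case
    using Suc d by (auto intro: differentiable_add)
qed

lemma smooth_fun_on_differentiable:
  assumes "smooth_fun_on f UNIV"
  shows "f differentiable at x"
proof -
  have "Ck_on (Suc 0) f UNIV" using assms unfolding smooth_fun_on_def by blast
  then show ?thesis by simp
qed

lemma smooth_fun_on_derivative:
  assumes "smooth_fun_on f UNIV" "i \<in> Basis"
  shows "smooth_fun_on (\<lambda>x. frechet_derivative f (at x) i) UNIV"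
  unfolding smooth_fun_on_def
proof
  fix k
  have "Ck_on (Suc k) f UNIV" using assms unfolding smooth_fun_on_def by blast
  then show "Ck_on k (\<lambda>x. frechet_derivative f (at x) i) UNIV" using assms(2) by simp
qed

lemma smooth_fun_on_const: "smooth_fun_on (\<lambda>_. c) S"
  by (simp add: smooth_fun_on_def Ck_on_const)

lemma smooth_fun_on_add:
  "smooth_fun_on f UNIV \<Longrightarrow> smooth_fun_on g UNIV \<Longrightarrow> smooth_fun_on (\<lambda>x. f x + g x) UNIV"
  by (simp add: smooth_fun_on_def Ck_on_add)

lemma smooth_fun_on_mult:
  assumes "smooth_fun_on f UNIV" "smooth_fun_on g UNIV"
  shows "smooth_fun_on (\<lambda>x. f x * g x) UNIV"
proof -
  have "Ck_on k (\<lambda>x. f x * g x) UNIV"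
    if "smooth_fun_on f UNIV" "smooth_fun_on g UNIV" for k and f g :: "'a \<Rightarrow> real"
    using that
  proof (induction k arbitrary: f g)
    case 0
    then have "Ck_on 0 f UNIV" "Ck_on 0 g UNIV" unfolding smooth_fun_on_def by blast+
    then show ?case by (auto intro: continuous_intros)
  next
    case (Suc k)
    note d = Suc.prems[THEN smooth_fun_on_differentiable]
    have deriv: "frechet_derivative (\<lambda>x. f x * g x) (at x) i =
        f x * frechet_derivative g (at x) i + frechet_derivative f (at x) i * g x" for x i
    proof -
      have "((\<lambda>x. f x * g x) has_derivative
          (\<lambda>h. f x * frechet_derivative g (at x) h + frechet_derivative f (at x) h * g x)) (at x)"
        using d[of x] unfolding frechet_derivative_works by (rule has_derivative_mult)
      from frechet_derivative_at[OF this] show ?thesis by (simp add: fun_eq_iff)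
    qed
    have "Ck_on k (\<lambda>x. f x * frechet_derivative g (at x) i + frechet_derivative f (at x) i * g x) UNIV"
      if "i \<in> Basis" for i
      by (intro Ck_on_add Suc.IH smooth_fun_on_derivative Suc.prems that)
    then show ?case using d by (simp add: deriv differentiable_mult)
  qed
  then show ?thesis using assms unfolding smooth_fun_on_def by blast
qed

lemma smooth_fun_on_continuous:
  assumes "smooth_fun_on f S"
  shows "continuous_on S f"
proof -
  have "Ck_on 0 f S" using assms unfolding smooth_fun_on_def by blast
  then show ?thesis by simp
qed

lemma quadratic_growth_at_maximum:
  fixes u :: "'a::euclidean_space \<Rightarrow> real"
  assumes u: "smooth_fun_on u UNIV" and max: "\<And>y. u y \<le> u 0" and bdd: "\<And>y. u 0 - u y \<le> B"
  obtains D where "0 \<le> D" "\<And>y. u 0 - u y \<le> D * (norm y)\<^sup>2"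
proof -
  define d where "d = (\<lambda>i x. frechet_derivative u (at x) i)"
  have has_d: "(u has_derivative frechet_derivative u (at x)) (at x)" for x
    using smooth_fun_on_differentiable[OF u] frechet_derivative_works by blast
  have "frechet_derivative u (at 0) = (\<lambda>_. 0)"
    by (rule differential_zero_maxmin[of 0 UNIV u]) (use has_d max in auto)
  then have d0: "d i 0 = 0" for i by (simp add: d_def)
  have "\<exists>L\<ge>0. \<forall>\<^sub>F x in nhds 0. \<bar>d i x\<bar> \<le> L * norm x" if i: "i \<in> Basis" for i
  proof -
    have "d i differentiable at 0"
      unfolding d_def by (rule smooth_fun_on_differentiable[OF smooth_fun_on_derivative[OF u i]])
    then obtain D where D: "(d i has_derivative D) (at 0)" unfolding differentiable_def by blast
    then obtain B where B: "0 < B" "\<And>x. norm (D x) \<le> norm x * B"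
      using has_derivative_bounded_linear bounded_linear.pos_bounded by blast
    obtain \<delta> where \<delta>: "0 < \<delta>" "\<And>x. norm x < \<delta> \<Longrightarrow> norm (d i x - D x) \<le> norm x"
      using D d0[of i] unfolding has_derivative_at_alt by (metis diff_zero mult_1 zero_less_one)
    have "\<bar>d i x\<bar> \<le> (B + 1) * norm x" if "norm x < \<delta>" for x
      using \<delta>(2)[OF that] B(2)[of x] by (simp add: algebra_simps)
    then have "\<forall>\<^sub>F x in nhds 0. \<bar>d i x\<bar> \<le> (B + 1) * norm x"
      using \<delta>(1) unfolding eventually_nhds_metric by (auto simp: dist_norm)
    then show ?thesis using B(1) by (intro exI[of _ "B + 1"]) auto
  qed
  then obtain L where L: "\<And>i. i \<in> Basis \<Longrightarrow> 0 \<le> L i"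
      "\<And>i. i \<in> Basis \<Longrightarrow> \<forall>\<^sub>F x in nhds 0. \<bar>d i x\<bar> \<le> L i * norm x"
    by metis
  have "\<forall>\<^sub>F x in nhds 0. \<forall>i\<in>Basis. \<bar>d i x\<bar> \<le> L i * norm x"
    using L(2) by (intro eventually_ball_finite) auto
  then obtain \<delta> where \<delta>: "0 < \<delta>" "\<And>x i. norm x < \<delta> \<Longrightarrow> i \<in> Basis \<Longrightarrow> \<bar>d i x\<bar> \<le> L i * norm x"
    unfolding eventually_nhds_metric by (auto simp: dist_norm)
  define E where "E = (\<Sum>i\<in>Basis. L i)"
  have E: "0 \<le> E" unfolding E_def by (intro sum_nonneg L)
  have near: "u 0 - u y \<le> E * (norm y)\<^sup>2" if y: "norm y < \<delta>" for y
  proof -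
    have ray: "((\<lambda>r. u (r *\<^sub>R y)) has_real_derivative frechet_derivative u (at (r *\<^sub>R y)) y) (at r)" for r
    proof -
      have "((u \<circ> (\<lambda>r. r *\<^sub>R y)) has_derivative (frechet_derivative u (at (r *\<^sub>R y)) \<circ> (\<lambda>h. h *\<^sub>R y))) (at r)"
        by (rule diff_chain_at[OF _ has_d]) (auto intro!: derivative_eq_intros)
      moreover have "frechet_derivative u (at (r *\<^sub>R y)) (h *\<^sub>R y) = h * frechet_derivative u (at (r *\<^sub>R y)) y" for h
        using linear_cmul[OF linear_frechet_derivative[OF smooth_fun_on_differentiable[OF u]]] by simp
      ultimately show ?thesis by (simp add: has_field_derivative_def o_def mult_commute_abs)
    qed
    obtain r where r: "0 < r" "r < 1" "u (1 *\<^sub>R y) - u (0 *\<^sub>R y) = (1 - 0) * frechet_derivative u (at (r *\<^sub>R y)) y"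
      using MVT2[of 0 1 "\<lambda>r. u (r *\<^sub>R y)" "\<lambda>r. frechet_derivative u (at (r *\<^sub>R y)) y"] ray by auto
    have "frechet_derivative u (at (r *\<^sub>R y)) y = (\<Sum>i\<in>Basis. (y \<bullet> i) * d i (r *\<^sub>R y))"
      by (subst euclidean_representation[of y, symmetric])
         (simp add: d_def linear_sum[OF linear_frechet_derivative[OF smooth_fun_on_differentiable[OF u]]]
           linear_cmul[OF linear_frechet_derivative[OF smooth_fun_on_differentiable[OF u]]])
    also have "\<bar>\<dots>\<bar> \<le> (\<Sum>i\<in>Basis. \<bar>(y \<bullet> i) * d i (r *\<^sub>R y)\<bar>)" by (rule sum_abs)
    also have "\<dots> \<le> (\<Sum>i\<in>Basis. norm y * (L i * norm y))"
    proof (rule sum_mono)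
      fix i :: 'a assume i: "i \<in> Basis"
      have ry: "norm (r *\<^sub>R y) \<le> norm y" using r by (simp add: mult_left_le_one_le)
      have "\<bar>d i (r *\<^sub>R y)\<bar> \<le> L i * norm (r *\<^sub>R y)" by (rule \<delta>(2)[OF le_less_trans[OF ry y] i])
      also have "\<dots> \<le> L i * norm y" using ry L(1)[OF i] by (rule mult_left_mono)
      finally have "\<bar>d i (r *\<^sub>R y)\<bar> \<le> L i * norm y" .
      then show "\<bar>(y \<bullet> i) * d i (r *\<^sub>R y)\<bar> \<le> norm y * (L i * norm y)"
        unfolding abs_mult using Basis_le_norm[OF i, of y] by (intro mult_mono) auto
    qed
    also have "\<dots> = E * (norm y)\<^sup>2"
      unfolding E_def sum_distrib_right by (intro sum.cong) (auto simp: power2_eq_square)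
    finally show ?thesis using r(3) by (simp add: abs_le_iff)
  qed
  have B: "0 \<le> B" using bdd[of 0] by simp
  have far: "u 0 - u y \<le> B / \<delta>\<^sup>2 * (norm y)\<^sup>2" if "\<delta> \<le> norm y" for y
  proof -
    have "\<delta>\<^sup>2 \<le> (norm y)\<^sup>2" using that \<delta>(1) by (intro power_mono) auto
    then have "B * \<delta>\<^sup>2 \<le> B * (norm y)\<^sup>2" using B by (rule mult_left_mono)
    then have "B \<le> B / \<delta>\<^sup>2 * (norm y)\<^sup>2" using \<delta>(1) by (simp add: pos_le_divide_eq)
    then show ?thesis using bdd[of y] by linarith
  qed
  have B': "0 \<le> B / \<delta>\<^sup>2" using B by simp
  have "u 0 - u y \<le> (E + B / \<delta>\<^sup>2) * (norm y)\<^sup>2" for y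
  proof (cases "norm y < \<delta>")
    case True
    moreover have "0 \<le> B / \<delta>\<^sup>2 * (norm y)\<^sup>2" using B' by (intro mult_nonneg_nonneg) auto
    ultimately show ?thesis using near[OF True] unfolding distrib_right by linarith
  next
    case False
    moreover have "0 \<le> E * (norm y)\<^sup>2" using E by (intro mult_nonneg_nonneg) auto
    ultimately show ?thesis using far[of y] unfolding distrib_right by linarith
  qed
  then show ?thesis using that[of "E + B / \<delta>\<^sup>2"] E B' by simp
qed

text \<open>Across a regular boundary point the defining function takes positive values.\<close>

lemma smooth_domain_complement_not_null:
  fixes \<Omega> :: "'a::euclidean_space set"
  assumes "smooth_domain \<Omega>" "\<Omega> \<noteq> UNIV"
  shows "emeasure lborel (UNIV - \<Omega>) \<noteq> 0"
proof
  assume null: "emeasure lborel (UNIV - \<Omega>) = 0"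
  have \<Omega>: "open \<Omega>" "\<Omega> \<noteq> {}" using assms by (auto simp: smooth_domain_def)
  then have "frontier \<Omega> \<noteq> {}" using assms(2) frontier_eq_empty by blast
  then obtain z where "z \<in> frontier \<Omega>" by blast
  then obtain U \<rho> where U: "open U" "z \<in> U" "smooth_fun_on \<rho> U" "frechet_derivative \<rho> (at z) \<noteq> (\<lambda>h. 0)"
      "\<rho> z = 0" "\<Omega> \<inter> U = {x \<in> U. \<rho> x < 0}"
    using assms(1) unfolding smooth_domain_def by blast
  have "Ck_on (Suc 0) \<rho> U" using U(3) unfolding smooth_fun_on_def by blast
  then have diff: "\<rho> differentiable at z" using U(2) by simp
  let ?d = "frechet_derivative \<rho> (at z)"
  have lin: "linear ?d" by (rule linear_frechet_derivative[OF diff])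
  obtain h where "?d h \<noteq> 0" using U(4) by auto
  then obtain h where h: "0 < ?d h"
    using linear_neg[OF lin, of h] by (metis neg_0_less_iff_less not_less_iff_gr_or_eq)
  have "((\<lambda>r. \<rho> (z + r *\<^sub>R h)) has_real_derivative ?d h) (at 0)"
  proof -
    have "(\<rho> has_derivative ?d) (at (z + 0 *\<^sub>R h))"
      using diff frechet_derivative_works by force
    then have "((\<rho> \<circ> (\<lambda>r. z + r *\<^sub>R h)) has_derivative (?d \<circ> (\<lambda>r. r *\<^sub>R h))) (at 0)"
      by (intro diff_chain_at) (auto intro!: derivative_eq_intros)
    then show ?thesis
      by (simp add: has_field_derivative_def o_def linear_cmul[OF lin] mult_commute_abs)
  qed
  then obtain e where e: "0 < e" "\<And>r. 0 < r \<Longrightarrow> r < e \<Longrightarrow> 0 < \<rho> (z + r *\<^sub>R h)"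
    using DERIV_pos_inc_right[of "\<lambda>r. \<rho> (z + r *\<^sub>R h)" "?d h" 0] h U(5) by auto
  have "((\<lambda>r. z + r *\<^sub>R h) \<longlongrightarrow> z + 0 *\<^sub>R h) (at_right 0)" by (intro tendsto_intros)
  then have "\<forall>\<^sub>F r in at_right 0. z + r *\<^sub>R h \<in> U"
    using U(1,2) by (intro topological_tendstoD[of _ z]) auto
  moreover have "\<forall>\<^sub>F r in at_right 0. r < e" using e(1) by (rule eventually_at_rightI[of 0 e, rotated]) auto
  ultimately have "\<forall>\<^sub>F r in at_right 0. z + r *\<^sub>R h \<in> U \<and> 0 < \<rho> (z + r *\<^sub>R h)"
    using eventually_at_right_less[of 0] by eventually_elim (auto intro: e)
  then obtain x where x: "x \<in> U" "0 < \<rho> x"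
    using eventually_happens[of _ "at_right (0::real)"] by auto
  define V where "V = U \<inter> \<rho> -` {0<..}"
  have "open V"
    unfolding V_def using smooth_fun_on_continuous[OF U(3)] U(1) by (intro continuous_open_preimage) auto
  moreover have "V \<noteq> {}" using x by (auto simp: V_def)
  moreover have "y \<notin> \<Omega>" if "y \<in> V" for y
  proof
    assume "y \<in> \<Omega>"
    moreover have "y \<in> U" "0 < \<rho> y" using that by (auto simp: V_def)
    ultimately have "y \<in> \<Omega> \<inter> U" by blast
    then have "\<rho> y < 0" unfolding U(6) by simp
    then show False using \<open>0 < \<rho> y\<close> by simp
  qed
  ultimately have V: "open V" "V \<noteq> {}" "V \<subseteq> UNIV - \<Omega>" by auto
  have "UNIV - \<Omega> \<in> null_sets lborel" using null \<Omega>(1) by (auto simp: null_sets_def)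
  then have "negligible (UNIV - \<Omega>)"
    by (simp add: negligible_iff_null_sets null_sets_completionI)
  then have "negligible V" using V(3) negligible_subset by blast
  then show False using open_not_negligible[OF V(1,2)] by blast
qed

lemma Phi_of_nonneg: "0 \<le> z \<Longrightarrow> Phi p z = z powr (p - 1)"
proof (cases "z = 0")
  case False
  assume "0 \<le> z"
  then have "z powr (p - 2) * z powr 1 = z powr (p - 1)"
    using False by (subst powr_add[symmetric]) simp
  then show ?thesis using \<open>0 \<le> z\<close> by (simp add: Phi_def)
qed (simp add: Phi_def)

theorem mainTheorem6:
  fixes s p C1 R :: real
    and \<Omega> :: "'a::euclidean_space set"
    and K :: "real \<Rightarrow> 'a \<Rightarrow> 'a \<Rightarrow> real"
    and u :: "'a \<Rightarrow> real"
  assumes s: "0 < s" "s < 1"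
    and p: "p \<ge> 2 / (2 - s)"
    and C1: "C1 > 0"
    and dom: "smooth_domain \<Omega>" "\<Omega> \<noteq> UNIV" "0 \<in> \<Omega>"
    and K: "dirichlet_heat_kernel \<Omega> K"
    and R: "R > 0" "ball 0 R \<subseteq> \<Omega>"
    and u_smooth: "smooth_fun_on u UNIV"
    and u_pos: "\<forall>x\<in>ball 0 R. u x > 0"
    and u_radial: "\<forall>x\<in>ball 0 R. \<forall>y\<in>ball 0 R. norm x = norm y \<longrightarrow> u x = u y"
    and u_decr: "\<forall>x\<in>ball 0 R. \<forall>y\<in>ball 0 R. norm x < norm y \<longrightarrow> u y < u x"
    and u_zero: "\<forall>x. x \<notin> ball 0 R \<longrightarrow> u x = 0"
  shows
    "let rhs =
      C2_const DIM('a) C1 s p *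
        (LINT t:{0<..}|lborel.
           (LINT y:\<Omega>|lborel. (heat_kernel t 0 y - K t 0 y) * Phi p (u 0 - u y))
             / t powr (1 + s * p / 2)) +
      C2_const DIM('a) C1 s p *
        (LINT t:{0<..}|lborel.
           (LINT y:UNIV - \<Omega>|lborel. heat_kernel t 0 y * Phi p (u 0 - u y))
             / t powr (1 + s * p / 2))
     in
      \<comment> \<open>the right-hand side converges and is positive\<close>
      iterated_integrable s p \<Omega> (\<lambda>t y. (heat_kernel t 0 y - K t 0 y) * Phi p (u 0 - u y)) \<and>
      iterated_integrable s p (UNIV - \<Omega>) (\<lambda>t y. heat_kernel t 0 y * Phi p (u 0 - u y)) \<and>
      rhs > 0 \<and>
      \<comment> \<open>both operators are finite at 0, except possibly at the endpoint, where they can only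
          diverge together\<close>
      (p > 2 / (2 - s) \<longrightarrow>
         frac_p_laplacian_defined C1 s p u 0 \<and> spec_p_laplacian_defined s p \<Omega> K u 0) \<and>
      (frac_p_laplacian_defined C1 s p u 0 \<longleftrightarrow> spec_p_laplacian_defined s p \<Omega> K u 0) \<and>
      (frac_p_laplacian_defined C1 s p u 0 \<longrightarrow>
         frac_p_laplacian C1 s p u 0 - spec_p_laplacian C1 s p \<Omega> K u 0 = rhs) \<and>
      \<comment> \<open>the same difference in principal-value form, also meaningful where the operators diverge\<close>
      (\<forall>\<epsilon>>0. frac_p_laplacian_trunc_defined s p u 0 \<epsilon> \<and>
             spec_p_laplacian_trunc_defined s p \<Omega> K u 0 \<epsilon>) \<and>
      ((\<lambda>\<epsilon>. frac_p_laplacian_trunc C1 s p u 0 \<epsilon> - spec_p_laplacian_trunc C1 s p \<Omega> K u 0 \<epsilon>)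
         \<longlongrightarrow> rhs) (at_right 0) \<and>
      \<comment> \<open>the two operators on functions vanishing outside the domain are different\<close>
      (\<exists>v. smooth_fun_on v UNIV \<and> (\<forall>x. x \<notin> \<Omega> \<longrightarrow> v x = 0) \<and>
         (\<exists>x\<in>\<Omega>. frac_p_laplacian_defined C1 s p v x \<and> spec_p_laplacian_defined s p \<Omega> K v x \<and>
                frac_p_laplacian C1 s p v x \<noteq> spec_p_laplacian C1 s p \<Omega> K v x))"
proof -
  have zero: "0 \<in> ball (0::'a) R" using R by simp
  have u0: "0 < u 0" using u_pos zero by blast
  have u_le: "u y \<le> u 0" for y
  proof (cases "y \<in> ball 0 R \<and> y \<noteq> 0")
    case True
    then have "u y < u 0" using u_decr zero by (metis norm_zero zero_less_norm_iff)
    then show ?thesis by simp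
  next
    case False
    then show ?thesis using u_zero u0 by (cases "y = 0") auto
  qed
  have u_nonneg: "0 \<le> u y" for y
    using u_pos u_zero by (cases "y \<in> ball 0 R") (auto simp: less_imp_le)
  have u_out: "u y = 0" if "y \<notin> \<Omega>" for y using u_zero R(2) that by blast
  have "2 / (2 - s) > 1" using s by (simp add: field_simps)
  then have p1: "1 < p" using p by linarith
  have sp: "0 < s * p" using s p1 by simp
  have u_meas [measurable]: "u \<in> borel_measurable borel"
    by (intro borel_measurable_continuous_onI smooth_fun_on_continuous u_smooth)
  obtain D where D: "0 \<le> D" "\<And>y. u 0 - u y \<le> D * (norm y)\<^sup>2"
    using quadratic_growth_at_maximum[OF u_smooth u_le, of "u 0"] u_nonneg by auto
  have powr_mono_p: "x powr (p - 1) \<le> y powr (p - 1)" if "0 \<le> x" "x \<le> y" for x y :: real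
    using that p1 by (intro powr_mono2) auto
  define v where "v = (\<lambda>x. u x * (2 * u 0 + - 1 * u x))"
  have v_diff: "v 0 - v y = (u 0 - u y)\<^sup>2" for y
    by (simp add: v_def power2_eq_square algebra_simps)
  have v_smooth: "smooth_fun_on v UNIV"
    unfolding v_def by (intro smooth_fun_on_mult smooth_fun_on_add smooth_fun_on_const u_smooth)
  have \<Omega>: "open \<Omega>" using dom by (simp add: smooth_domain_def)
  note complement = smooth_domain_complement_not_null[OF dom(1,2)]
  interpret A: kernel_comparison s p C1 R "u 0 powr (p - 1)" \<Omega> K u
  proof
    show "(\<lambda>y. Phi p (u 0 - u y)) \<in> borel_measurable borel" unfolding Phi_def by measurable
    fix y
    show "0 \<le> Phi p (u 0 - u y)" "Phi p (u 0 - u y) \<le> u 0 powr (p - 1)"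
      using u_le[of y] u_nonneg[of y] by (auto simp: Phi_of_nonneg intro!: powr_mono_p)
    show "0 < Phi p (u 0 - u y)" if "y \<notin> \<Omega>"
      using u0 u_out[OF that] by (simp add: Phi_of_nonneg)
  qed (fact sp C1 \<Omega> R K complement)+
  interpret B: kernel_comparison s p C1 R "((u 0)\<^sup>2) powr (p - 1)" \<Omega> K v
  proof
    show "(\<lambda>y. Phi p (v 0 - v y)) \<in> borel_measurable borel" unfolding Phi_def v_diff by measurable
    fix y
    have "(u 0 - u y)\<^sup>2 \<le> (u 0)\<^sup>2" using u_le[of y] u_nonneg[of y] by (intro power_mono) auto
    then show "0 \<le> Phi p (v 0 - v y)" "Phi p (v 0 - v y) \<le> ((u 0)\<^sup>2) powr (p - 1)"
      unfolding v_diff by (auto simp: Phi_of_nonneg intro!: powr_mono_p)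
    show "0 < Phi p (v 0 - v y)" if "y \<notin> \<Omega>"
      unfolding v_diff using u0 u_out[OF that] by (simp add: Phi_of_nonneg)
  qed (fact sp C1 \<Omega> R K complement)+
  have Phi_growth: "Phi p (u 0 - u y) \<le> D powr (p - 1) * norm y powr (2 * (p - 1))" for y
  proof -
    have "Phi p (u 0 - u y) \<le> (D * (norm y)\<^sup>2) powr (p - 1)"
      using D u_le[of y] by (simp add: Phi_of_nonneg powr_mono_p)
    also have "\<dots> = D powr (p - 1) * norm y powr (2 * (p - 1))"
    proof -
      have "((norm y)\<^sup>2) powr (p - 1) = norm y powr (2 * (p - 1))"
        by (cases "y = 0") (simp_all add: powr_powr powr_numeral[symmetric] del: powr_numeral)
      then show ?thesis using D(1) by (simp add: powr_mult)
    qed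
    finally show ?thesis .
  qed
  have Phi_growth_v: "Phi p (v 0 - v y) \<le> (D powr (p - 1))\<^sup>2 * norm y powr (2 * (2 * (p - 1)))" for y
  proof -
    have "Phi p (v 0 - v y) = (Phi p (u 0 - u y))\<^sup>2"
      unfolding v_diff using u_le[of y]
      by (simp add: Phi_of_nonneg power2_eq_square powr_mult)
    also have "\<dots> \<le> (D powr (p - 1) * norm y powr (2 * (p - 1)))\<^sup>2"
      using Phi_growth[of y] A.Phi_nonneg[of y] by (rule power_mono)
    also have "\<dots> = (D powr (p - 1))\<^sup>2 * norm y powr (2 * (2 * (p - 1)))"
      unfolding power_mult_distrib
      by (simp add: power2_eq_square powr_add[symmetric])
    finally show ?thesis .
  qed
  have B_def: "frac_p_laplacian_defined C1 s p v 0"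
  proof (rule B.frac_defined_of_growth[OF _ Phi_growth_v])
    have "2 \<le> p * (2 - s)" using s p by (simp add: pos_divide_le_eq)
    then show "s * p / 2 < 2 * (p - 1)" using p1 by (simp add: algebra_simps)
  qed
  have A_def: "frac_p_laplacian_defined C1 s p u 0" if "p > 2 / (2 - s)"
  proof (rule A.frac_defined_of_growth[OF _ Phi_growth])
    have "2 < p * (2 - s)" using s that by (simp add: pos_divide_less_eq)
    then show "s * p / 2 < p - 1" by (simp add: algebra_simps)
  qed
  have rhs: "C2_const DIM('a) C1 s p *
        (LINT t:{0<..}|lborel.
           (LINT y:\<Omega>|lborel. (heat_kernel t 0 y - K t 0 y) * Phi p (u 0 - u y))
             / t powr (1 + s * p / 2)) +
      C2_const DIM('a) C1 s p *
        (LINT t:{0<..}|lborel.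
           (LINT y:UNIV - \<Omega>|lborel. heat_kernel t 0 y * Phi p (u 0 - u y))
             / t powr (1 + s * p / 2)) = A.rhs"
    by (simp only: A.rhs_def A.c2_def A.g_def)
  have defined_iff: "frac_p_laplacian_defined C1 s p u 0 \<longleftrightarrow> spec_p_laplacian_defined s p \<Omega> K u 0"
    using A.frac_defined_iff A.spec_defined_iff by simp
  have "frac_p_laplacian C1 s p v 0 - spec_p_laplacian C1 s p \<Omega> K v 0 > 0"
    using B.difference_eq_rhs[OF B_def] B.rhs_pos by simp
  then have neq: "frac_p_laplacian C1 s p v 0 \<noteq> spec_p_laplacian C1 s p \<Omega> K v 0" by simp
  have v_out: "\<forall>x. x \<notin> \<Omega> \<longrightarrow> v x = 0" using u_out by (simp add: v_def)
  have B_spec: "spec_p_laplacian_defined s p \<Omega> K v 0"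
    using B_def B.frac_defined_iff B.spec_defined_iff by simp
  show ?thesis
    unfolding Let_def rhs
  proof (intro conjI)
    show "iterated_integrable s p \<Omega> (\<lambda>t y. (heat_kernel t 0 y - K t 0 y) * Phi p (u 0 - u y))"
      using A.iterated_integrable_Dg by (simp only: A.g_def)
    show "iterated_integrable s p (UNIV - \<Omega>) (\<lambda>t y. heat_kernel t 0 y * Phi p (u 0 - u y))"
      using A.iterated_integrable_complement by (simp only: A.g_def)
    show "0 < A.rhs" by (rule A.rhs_pos)
    show "p > 2 / (2 - s) \<longrightarrow>
        frac_p_laplacian_defined C1 s p u 0 \<and> spec_p_laplacian_defined s p \<Omega> K u 0"
      using A_def defined_iff by blast
    show "frac_p_laplacian_defined C1 s p u 0 \<longleftrightarrow> spec_p_laplacian_defined s p \<Omega> K u 0"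
      by (rule defined_iff)
    show "frac_p_laplacian_defined C1 s p u 0 \<longrightarrow>
        frac_p_laplacian C1 s p u 0 - spec_p_laplacian C1 s p \<Omega> K u 0 = A.rhs"
      using A.difference_eq_rhs by blast
    show "\<forall>\<epsilon>>0. frac_p_laplacian_trunc_defined s p u 0 \<epsilon> \<and> spec_p_laplacian_trunc_defined s p \<Omega> K u 0 \<epsilon>"
      using A.frac_trunc(1) A.spec_trunc(1) by blast
    show "((\<lambda>\<epsilon>. frac_p_laplacian_trunc C1 s p u 0 \<epsilon> - spec_p_laplacian_trunc C1 s p \<Omega> K u 0 \<epsilon>)
        \<longlongrightarrow> A.rhs) (at_right 0)"
      by (rule A.tendsto_difference_trunc)
    show "\<exists>v. smooth_fun_on v UNIV \<and> (\<forall>x. x \<notin> \<Omega> \<longrightarrow> v x = 0) \<and>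
         (\<exists>x\<in>\<Omega>. frac_p_laplacian_defined C1 s p v x \<and> spec_p_laplacian_defined s p \<Omega> K v x \<and>
                frac_p_laplacian C1 s p v x \<noteq> spec_p_laplacian C1 s p \<Omega> K v x)"
      using v_smooth v_out B_def B_spec neq dom(3) by blast
  qed
qed

end
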